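(* The equation $$\frac{3\sqrt{2\pi}}{C}\int_0^3\Bigl(1-\frac r3\Bigr)^2\exp\!\Bigl(-\frac{\pi^2r^2}{2C^2}\Bigr)\,dr=1$$ has a unique solution $C=C_{\mathrm{cos}}$ in $(0,\infty)$, and $C_{\mathrm{cos}}\in(6.9012574,\,6.9012575)$. Moreover, for all $n,d\ge1$ and all vectors $v_1,\ldots,v_n\in\mathbb{R}^d$ with $\|v_j\|_2\le1$ for every $j$, there is $\varepsilon\in\{-1,1\}^n$ such that $$\Bigl\|\sum_{j=1}^n\varepsilon_jv_j\Bigr\|_\infty<C_{\mathrm{cos}}<6.9013 .$$
   Context: $\|\cdot\|_2$ is the Euclidean norm and $\|\cdot\|_\infty$ the maximum absolute value of the coordinates on $\mathbb{R}^d$. *)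

theory Defs
  imports "HOL-Analysis.Analysis"
begin

definition cos_lhs :: "real \<Rightarrow> real" where
  "cos_lhs C = 3 * sqrt (2 * pi) / C *
     integral {0..3} (\<lambda>r. (1 - r / 3)\<^sup>2 * exp (- (pi\<^sup>2 * r\<^sup>2 / (2 * C\<^sup>2))))"

(* meaningful because the theorem using it asserts that exactly one such C exists *)
definition C_cos :: real where
  "C_cos = (THE C. C > 0 \<and> cos_lhs C = 1)"

end

theory Submission
  imports Defs "HOL-Probability.Probability" "HOL-Complex_Analysis.Complex_Analysis"
    "HOL-Real_Asymp.Real_Asymp"
begin

text \<open>
  After scaling by C, let f be the density of the product of the laws \<open>2 sin\<^sup>2 (\<pi>s) ds\<close> on
  \<open>H = (0,1)\<^sup>d\<close>. It suffices to find \<open>a, b \<in> [0,3]\<^sup>n\<close> with \<open>a - b \<in> {-1,1}\<^sup>n\<close> and a point x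
  such that \<open>x - \<Sum>a\<^sub>j v\<^sub>j\<close> and \<open>x - \<Sum>b\<^sub>j v\<^sub>j\<close> both lie in H. Consider
  \<open>F(x,a) = f(x - \<Sum>a\<^sub>j v\<^sub>j)\<close> and rearrange it decreasingly in each \<open>a\<^sub>j\<close> in turn. Rearrangement
  preserves mass, contracts L1 distances between translates, and keeps the support inside a convex set
  (shaking). If the expected total variation distance between \<open>f(\<cdot> - s v)\<close> and \<open>f(\<cdot> - s' v)\<close>,
  with s and s' uniform in [0,3], is at most 1/3 for each vector v, then every coordinate of the
  barycentre of the rearranged mass is at least 1. By convexity the barycentre lies in the shaken set,
  so the original set has chords of length at least 1, nested through all coordinates; and any two
  intervals of length 1 in [0,3] contain points at distance exactly 1.

  The total variation estimate is Fourier analytic: the overlap of f and its translate is an integral of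
  \<open>exp (- \<bar>Y\<bar>)\<close>, with Y half the log-likelihood ratio, and \<open>exp (- \<bar>Y\<bar>)\<close> has a
  positive Fourier transform, while the transform of Y, computed in closed form, dominates that
  of the Gaussian shift with the same Fisher information. Hence the total variation distance is
  strictly below the Gaussian one, for which the average over s and s' equals one third of
  \<open>cos_lhs C\<close>.
\<close>

section \<open>Nested chords\<close>

text \<open>The length 3 is the largest for which any two intervals of length 1 inside contain
  points at distance exactly 1. The mean of a decreasing rearrangement on [0,3] is 3/2 minus 3/2
  times the expected total variation distance; requiring mean 1 gives the threshold 1/3.

  Rearranging in one variable destroys the formula for the density in the others, so only facts that
  survive rearrangement are used: mass, L1 contraction, convex support. On a finite grid, with the
  subgraph in place of the density, these become counting statements about finite index sets, and
  the barycentre becomes a finite convex combination.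

  The density 2 sin^2 (pi s) minimises the Fisher information on the unit interval. The obstacle in
  high dimension is that the minimum of two product densities is not a product; their likelihood
  ratio is one, so characteristic functions factor. The comparison in each coordinate is made for
  shifts up to 1/2. Shifts reach 3/C, which asks for C at least 6. The strict gap to the Gaussian
  pays for the passage to the grid without enlarging C; the final bound is strict because the cube
  is open.\<close>

text \<open>\<open>reach H vs l x\<close> says that x lies in the shaken set at the parameters l; the chord condition is
  spelled out as a binary tree of endpoints, which makes joint convexity in l and x evident.\<close>

fun reach :: "'b::real_vector set \<Rightarrow> 'b list \<Rightarrow> (nat \<Rightarrow> real) \<Rightarrow> 'b \<Rightarrow> bool" where
  "reach H [] l x \<longleftrightarrow> x \<in> H"
| "reach H (v # vs) l x \<longleftrightarrow> (\<exists>p q. 0 \<le> p \<and> p + l 0 \<le> q \<and> q \<le> 3 \<and>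
     reach H vs (\<lambda>j. l (Suc j)) (x - p *\<^sub>R v) \<and> reach H vs (\<lambda>j. l (Suc j)) (x - q *\<^sub>R v))"

lemma reach_convex_combination:
  assumes "convex H" "finite I" "\<And>i. i \<in> I \<Longrightarrow> 0 \<le> w i" "sum w I = 1"
    and "\<And>i. i \<in> I \<Longrightarrow> reach H vs (l i) (x i)"
  shows "reach H vs (\<lambda>j. \<Sum>i\<in>I. w i * l i j) (\<Sum>i\<in>I. w i *\<^sub>R x i)"
  using assms(5)
proof (induction vs arbitrary: l x)
  case Nil
  then show ?case using assms by (auto intro!: convex_sum)
next
  case (Cons v vs)
  then have "\<forall>i\<in>I. \<exists>p q. 0 \<le> p \<and> p + l i 0 \<le> q \<and> q \<le> 3 \<and>
     reach H vs (\<lambda>j. l i (Suc j)) (x i - p *\<^sub>R v) \<and> reach H vs (\<lambda>j. l i (Suc j)) (x i - q *\<^sub>R v)"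
    by auto
  then obtain p q where pq: "\<And>i. i \<in> I \<Longrightarrow> 0 \<le> p i" "\<And>i. i \<in> I \<Longrightarrow> p i + l i 0 \<le> q i"
    "\<And>i. i \<in> I \<Longrightarrow> q i \<le> 3"
    "\<And>i. i \<in> I \<Longrightarrow> reach H vs (\<lambda>j. l i (Suc j)) (x i - p i *\<^sub>R v)"
    "\<And>i. i \<in> I \<Longrightarrow> reach H vs (\<lambda>j. l i (Suc j)) (x i - q i *\<^sub>R v)"
    by metis
  have shift: "(\<Sum>i\<in>I. w i *\<^sub>R (x i - s i *\<^sub>R v)) = (\<Sum>i\<in>I. w i *\<^sub>R x i) - (\<Sum>i\<in>I. w i * s i) *\<^sub>R v" for s
    by (simp add: algebra_simps sum_subtractf scaleR_sum_left)
  have p: "reach H vs (\<lambda>j. \<Sum>i\<in>I. w i * l i (Suc j)) ((\<Sum>i\<in>I. w i *\<^sub>R x i) - (\<Sum>i\<in>I. w i * p i) *\<^sub>R v)"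
    using Cons.IH[of "\<lambda>i j. l i (Suc j)" "\<lambda>i. x i - p i *\<^sub>R v"] pq(4) by (simp add: shift)
  have q: "reach H vs (\<lambda>j. \<Sum>i\<in>I. w i * l i (Suc j)) ((\<Sum>i\<in>I. w i *\<^sub>R x i) - (\<Sum>i\<in>I. w i * q i) *\<^sub>R v)"
    using Cons.IH[of "\<lambda>i j. l i (Suc j)" "\<lambda>i. x i - q i *\<^sub>R v"] pq(5) by (simp add: shift)
  have "0 \<le> (\<Sum>i\<in>I. w i * p i)"
    using assms pq by (intro sum_nonneg) auto
  moreover have "(\<Sum>i\<in>I. w i * p i) + (\<Sum>i\<in>I. w i * l i 0) \<le> (\<Sum>i\<in>I. w i * q i)"
    unfolding sum.distrib[symmetric] distrib_left[symmetric]
    using assms pq by (intro sum_mono mult_left_mono) auto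
  moreover have "(\<Sum>i\<in>I. w i * q i) \<le> (\<Sum>i\<in>I. w i * 3)"
    using assms pq by (intro sum_mono mult_left_mono) auto
  then have "(\<Sum>i\<in>I. w i * q i) \<le> 3"
    using assms by (simp add: sum_distrib_right[symmetric])
  ultimately show ?case
    using p q by auto
qed

text \<open>Joint convexity for two points with equal parameters: their average is again l, so the
  set reached at fixed l is convex and a chord may be entered anywhere between its ends.\<close>

lemma reach_segment:
  assumes "convex H" "reach H vs l (x - p *\<^sub>R v)" "reach H vs l (x - q *\<^sub>R v)" "p \<le> s" "s \<le> q"
  shows "reach H vs l (x - s *\<^sub>R v)"
proof (cases "p = q")
  case True
  then show ?thesis using assms by auto
next
  case False
  define w where "w = (s - p) / (q - p)"
  have w: "0 \<le> w" "w \<le> 1" using assms False by (auto simp: w_def field_simps)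
  have s: "s = (1 - w) * p + w * q"
  proof -
    have "w * (q - p) = s - p" using False by (simp add: w_def)
    then show ?thesis by (simp add: algebra_simps)
  qed
  have "reach H vs (\<lambda>j. \<Sum>i\<in>{False,True}. (if i then w else 1 - w) * l j)
     (\<Sum>i\<in>{False,True}. (if i then w else 1 - w) *\<^sub>R (x - (if i then q else p) *\<^sub>R v))"
    using assms w by (intro reach_convex_combination) auto
  moreover have "(\<lambda>j. \<Sum>i\<in>{False,True}. (if i then w else 1 - w) * l j) = l"
    by (auto simp: algebra_simps)
  moreover have "(\<Sum>i\<in>{False,True}. (if i then w else 1 - w) *\<^sub>R (x - (if i then q else p) *\<^sub>R v)) = x - s *\<^sub>R v"
    unfolding s by (simp add: algebra_simps)
  ultimately show ?thesis by simp
qed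

text \<open>When the left ends are at most 1 apart, the earlier left end and the point one unit to
  its right do. Otherwise the later interval, having length at least 1 and ending by 3, starts at 2
  or before, so the point one unit before its start is at most 1 and still lies in the earlier
  interval.\<close>

lemma unit_distance_in_intervals:
  fixes p q p' q' :: real
  assumes "0 \<le> p" "p + 1 \<le> q" "q \<le> 3" "0 \<le> p'" "p' + 1 \<le> q'" "q' \<le> 3"
  obtains s s' where "p \<le> s" "s \<le> q" "p' \<le> s'" "s' \<le> q'" "s - s' \<in> {-1, 1}"
proof (cases "p' \<le> p")
  case True
  show ?thesis
  proof (cases "p \<le> p' + 1")
    case True
    then show ?thesis using that[of "p' + 1" p'] assms \<open>p' \<le> p\<close> by auto
  next
    case False
    then show ?thesis using that[of p "p - 1"] assms \<open>p' \<le> p\<close> by auto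
  qed
next
  case False
  show ?thesis
  proof (cases "p' \<le> p + 1")
    case True
    then show ?thesis using that[of p "p + 1"] assms False by auto
  next
    case F: False
    then show ?thesis using that[of "p' - 1" p'] assms False by auto
  qed
qed

text \<open>Two starting points are carried along since they separate after the first vector, even
  when they coincide at the outset as in the application. At each vector both chords have length at
  least 1, so they can be entered at parameters that differ by exactly 1; this difference is the
  sign.\<close>

lemma reach_imp_signed_sum:
  assumes "convex H" "\<And>j. j < length vs \<Longrightarrow> 1 \<le> l j" "\<And>j. j < length vs \<Longrightarrow> 1 \<le> l' j"
    and "reach H vs l x" "reach H vs l' y"
  shows "\<exists>e p q. (\<forall>j. e j \<in> {-1, 1::real}) \<and> p \<in> H \<and> q \<in> H \<and>
     p - q = (x - y) + (\<Sum>j<length vs. e j *\<^sub>R vs ! j)"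
  using assms(2-)
proof (induction vs arbitrary: l l' x y)
  case Nil
  then show ?case by (intro exI[of _ "\<lambda>_. 1"] exI[of _ x] exI[of _ y]) auto
next
  case (Cons v vs)
  from Cons.prems(3) obtain p q where pq: "0 \<le> p" "p + l 0 \<le> q" "q \<le> 3"
    "reach H vs (\<lambda>j. l (Suc j)) (x - p *\<^sub>R v)" "reach H vs (\<lambda>j. l (Suc j)) (x - q *\<^sub>R v)"
    by auto
  from Cons.prems(4) obtain p' q' where pq': "0 \<le> p'" "p' + l' 0 \<le> q'" "q' \<le> 3"
    "reach H vs (\<lambda>j. l' (Suc j)) (y - p' *\<^sub>R v)" "reach H vs (\<lambda>j. l' (Suc j)) (y - q' *\<^sub>R v)"
    by auto
  have "1 \<le> l 0" "1 \<le> l' 0" using Cons.prems(1,2)[of 0] by auto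
  then obtain s s' where s: "p \<le> s" "s \<le> q" "p' \<le> s'" "s' \<le> q'" "s - s' \<in> {-1, 1}"
    using unit_distance_in_intervals[of p q p' q'] pq pq' by auto
  have "reach H vs (\<lambda>j. l (Suc j)) (x - s *\<^sub>R v)" "reach H vs (\<lambda>j. l' (Suc j)) (y - s' *\<^sub>R v)"
    using pq pq' s assms(1) by (auto intro: reach_segment)
  then obtain e a b where e: "\<forall>j. e j \<in> {-1, 1::real}" "a \<in> H" "b \<in> H"
     "a - b = ((x - s *\<^sub>R v) - (y - s' *\<^sub>R v)) + (\<Sum>j<length vs. e j *\<^sub>R vs ! j)"
    using Cons.IH[of "\<lambda>j. l (Suc j)" "\<lambda>j. l' (Suc j)" "x - s *\<^sub>R v" "y - s' *\<^sub>R v"] Cons.prems(1,2)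
    by fastforce
  define e' where "e' = (\<lambda>j. case j of 0 \<Rightarrow> s' - s | Suc i \<Rightarrow> e i)"
  have "\<forall>j. e' j \<in> {-1, 1::real}"
    using e(1) s(5) by (auto simp: e'_def split: nat.split)
  moreover have "a - b = (x - y) + (\<Sum>j<length (v # vs). e' j *\<^sub>R (v # vs) ! j)"
    by (simp add: e(4) e'_def sum.lessThan_Suc_shift algebra_simps del: sum.lessThan_Suc)
  ultimately show ?case using e(2,3) by blast
qed

text \<open>The set \<open>rearranged m B vs ks\<close> is the section at the rearranged parameters \<open>ks\<close>, with the interval
  [0,3] replaced by the grid \<open>3i/m\<close>, \<open>i < m\<close>. The density is encoded by its subgraph, so that
  rearranging a function becomes counting points of a set.\<close>

fun rearranged :: "nat \<Rightarrow> 'b::real_vector set \<Rightarrow> 'b list \<Rightarrow> nat list \<Rightarrow> 'b set" where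
  "rearranged m B (v # vs) (k # ks) = {x. k < card {i\<in>{..<m}. x - (3 * real i / real m) *\<^sub>R v \<in> rearranged m B vs ks}}"
| "rearranged m B _ _ = B"

text \<open>More than k good indices span at least k steps from the smallest to the largest, so the
  two extreme indices serve as endpoints of the chord.\<close>

lemma rearranged_imp_reach:
  assumes "B \<subseteq> H" "x \<in> rearranged m B vs ks" "length ks = length vs"
  shows "reach H vs (\<lambda>j. 3 * real (ks ! j) / real m) x"
  using assms(2,3)
proof (induction vs arbitrary: ks x)
  case Nil
  then show ?case using assms by auto
next
  case (Cons v vs)
  then obtain k ks' where ks: "ks = k # ks'" "length ks' = length vs" by (cases ks) auto
  define I where "I = {i\<in>{..<m}. x - (3 * real i / real m) *\<^sub>R v \<in> rearranged m B vs ks'}"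
  have k: "k < card I" using Cons.prems by (simp add: ks I_def)
  have fin: "finite I" by (simp add: I_def)
  have ne: "I \<noteq> {}" using k by auto
  have "I \<subseteq> {Min I..Max I}" using fin ne by auto
  then have "card I \<le> Suc (Max I) - Min I"
    using card_mono[of "{Min I..Max I}" I] by simp
  then have kk: "k + Min I \<le> Max I" using k by simp
  have mem: "Min I \<in> I" "Max I \<in> I" using fin ne by auto
  then have r: "reach H vs (\<lambda>j. 3 * real (ks' ! j) / real m) (x - (3 * real i / real m) *\<^sub>R v)"
    if "i \<in> {Min I, Max I}" for i
    using that Cons.IH[OF _ ks(2)] by (auto simp: I_def)
  have m: "Max I < m" using mem by (auto simp: I_def)
  have "3 * real (Min I) / real m + 3 * real k / real m \<le> 3 * real (Max I) / real m"
    using kk m by (simp add: add_divide_distrib[symmetric] divide_le_cancel)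
  moreover have "3 * real (Max I) / real m \<le> 3" using m by (simp add: field_simps)
  moreover have "0 \<le> 3 * real (Min I) / real m" by simp
  ultimately show ?case
    using r[of "Min I"] r[of "Max I"] unfolding ks reach.simps nth_Cons_0 nth_Cons_Suc by blast
qed

section \<open>Rearrangement of one set along the grid\<close>

definition translate :: "'b::euclidean_space \<Rightarrow> 'b set \<Rightarrow> 'b set" where
  "translate y B = {x. x - y \<in> B}"

lemma translate_measurable [measurable]: "B \<in> sets borel \<Longrightarrow> translate y B \<in> sets borel"
proof -
  assume "B \<in> sets borel"
  then have "(\<lambda>x. x - y) -` B \<inter> space borel \<in> sets borel"
    by (intro measurable_sets[where A=borel]) auto
  then show ?thesis by (simp add: translate_def vimage_def)
qed

lemma emeasure_translate:
  fixes y :: "'b::euclidean_space"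
  assumes [measurable]: "B \<in> sets borel"
  shows "emeasure lborel (translate y B) = emeasure lborel B"
proof -
  have "emeasure lborel B = emeasure (distr lborel borel ((+) (- y))) B"
    by (simp add: lborel_distr_plus)
  also have "\<dots> = emeasure lborel (translate y B)"
    by (subst emeasure_distr) (auto simp: translate_def vimage_def)
  finally show ?thesis by simp
qed

lemma measure_translate:
  "B \<in> sets borel \<Longrightarrow> measure lborel (translate y B) = measure lborel B"
  by (simp add: measure_def emeasure_translate)

lemma translate_diff_translate:
  "translate a X - translate b X = translate a (X - translate (b - a) X)"
  by (auto simp: translate_def algebra_simps)

text \<open>Reduces the measure statements below to inequalities between counts at a single point.
  The coefficients may have either sign, and equalities follow by applying it in both
  directions.\<close>

lemma sum_measure_mono:
  fixes A :: "'i \<Rightarrow> 'b::euclidean_space set" and C :: "'j \<Rightarrow> 'b set"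
  assumes "finite I" "finite J"
    and A: "\<And>i. i \<in> I \<Longrightarrow> A i \<in> sets borel" "\<And>i. i \<in> I \<Longrightarrow> emeasure lborel (A i) < \<infinity>"
    and C: "\<And>j. j \<in> J \<Longrightarrow> C j \<in> sets borel" "\<And>j. j \<in> J \<Longrightarrow> emeasure lborel (C j) < \<infinity>"
    and le: "\<And>x. (\<Sum>i\<in>I. a i * indicator (A i) x) \<le> (\<Sum>j\<in>J. c j * indicator (C j) x)"
  shows "(\<Sum>i\<in>I. a i * measure lborel (A i)) \<le> (\<Sum>j\<in>J. c j * (measure lborel (C j) :: real))"
proof -
  have intA: "integrable lborel (\<lambda>x. a i * indicator (A i) x :: real)" if "i \<in> I" for i
    using A that by (intro integrable_mult_right integrable_real_indicator) auto
  have intC: "integrable lborel (\<lambda>x. c j * indicator (C j) x :: real)" if "j \<in> J" for j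
    using C that by (intro integrable_mult_right integrable_real_indicator) auto
  have "(\<Sum>i\<in>I. a i * measure lborel (A i)) = (\<integral>x. (\<Sum>i\<in>I. a i * indicator (A i) x) \<partial>lborel)"
    using A intA by (subst Bochner_Integration.integral_sum) (auto intro!: sum.cong)
  also have "\<dots> \<le> (\<integral>x. (\<Sum>j\<in>J. c j * indicator (C j) x) \<partial>lborel)"
    using intA intC by (intro integral_mono le Bochner_Integration.integrable_sum) auto
  also have "\<dots> = (\<Sum>j\<in>J. c j * measure lborel (C j))"
    using C intC by (subst Bochner_Integration.integral_sum) (auto intro!: sum.cong)
  finally show ?thesis .
qed

lemma card_indicator: "finite I \<Longrightarrow> real (card {i\<in>I. P i}) = (\<Sum>i\<in>I. if P i then 1 else 0)"
  by (subst sum.inter_filter[symmetric]) auto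

context
  fixes m :: nat and L :: "'b::euclidean_space set" and v :: 'b
  assumes L: "L \<in> sets borel" and fin: "emeasure lborel L < \<infinity>"
begin

abbreviation grid_translate where "grid_translate i \<equiv> translate ((3 * real i / real m) *\<^sub>R v) L"
abbreviation grid_count where "grid_count x \<equiv> card {i\<in>{..<m}. x - (3 * real i / real m) *\<^sub>R v \<in> L}"

lemma grid_count_eq: "real (grid_count x) = (\<Sum>i<m. indicator (grid_translate i) x)"
  unfolding card_indicator[OF finite_lessThan]
  by (intro sum.cong refl) (simp add: translate_def indicator_def)

lemma grid_count_le: "grid_count x \<le> m"
  using card_mono[of "{..<m}" "{i\<in>{..<m}. x - (3 * real i / real m) *\<^sub>R v \<in> L}"] by auto

lemma grid_translate_measurable [measurable]: "grid_translate i \<in> sets borel" using L by (rule translate_measurable)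

lemma level_set_measurable: "{x. k < grid_count x} \<in> sets borel"
proof -
  have "{x. k < grid_count x} = {x\<in>space borel. real k < (\<Sum>i<m. indicator (grid_translate i) x)}"
    by (simp add: grid_count_eq[symmetric])
  also have "\<dots> \<in> sets borel" by measurable
  finally show ?thesis .
qed

lemma level_set_finite: "emeasure lborel {x. k < grid_count x} < \<infinity>"
proof -
  have "{x. k < grid_count x} \<subseteq> (\<Union>i\<in>{..<m}. grid_translate i)"
  proof
    fix x assume "x \<in> {x. k < grid_count x}"
    then have "{i\<in>{..<m}. x - (3 * real i / real m) *\<^sub>R v \<in> L} \<noteq> {}"
      by (metis (no_types, lifting) card.empty less_nat_zero_code mem_Collect_eq)
    then show "x \<in> (\<Union>i\<in>{..<m}. grid_translate i)" by (auto simp: translate_def)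
  qed
  then have "emeasure lborel {x. k < grid_count x} \<le> emeasure lborel (\<Union>i\<in>{..<m}. grid_translate i)"
    by (intro emeasure_mono) (auto simp: grid_translate_measurable)
  also have "\<dots> \<le> (\<Sum>i<m. emeasure lborel (grid_translate i))"
    by (intro emeasure_subadditive_finite) (auto simp: grid_translate_measurable)
  also have "\<dots> < \<infinity>"
    using fin by (simp add: emeasure_translate L ennreal_mult_less_top of_nat_less_top)
  finally show ?thesis .
qed

lemma sum_level: "(\<Sum>k<m. if k < c then f k else (0::real)) = (\<Sum>k<c. f k)" if "c \<le> m"
  using that by (subst sum.inter_filter[symmetric]) (auto intro!: sum.cong)

text \<open>Layer cake at a point: as many levels lie below the count as there are translates
  containing the point.\<close>

lemma sum_measure_level_sets: "(\<Sum>k<m. measure lborel {x. k < grid_count x}) = m * measure lborel L"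
proof -
  have eq: "(\<Sum>k<m. 1 * indicator {x. k < grid_count x} x) = (\<Sum>i<m. 1 * indicator (grid_translate i) x :: real)" for x
  proof -
    have "(\<Sum>k<m. 1 * indicator {x. k < grid_count x} x) = (\<Sum>k<m. if k < grid_count x then 1 else (0::real))"
      by (intro sum.cong refl) (simp add: indicator_def)
    also have "\<dots> = (\<Sum>k<grid_count x. 1)" by (rule sum_level[OF grid_count_le])
    also have "\<dots> = real (grid_count x)" by simp
    finally show ?thesis unfolding grid_count_eq by simp
  qed
  have "(\<Sum>k<m. 1 * measure lborel {x. k < grid_count x}) = (\<Sum>i<m. 1 * measure lborel (grid_translate i))"
    using fin by (intro antisym sum_measure_mono)
      (auto simp only: eq finite_lessThan level_set_measurable level_set_finite grid_translate_measurable emeasure_translate L)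
  then show ?thesis by (simp add: measure_translate L)
qed

text \<open>At a point, the levels lost number the positive part of the difference of two counts,
  and the first index set has at least that many elements outside the second. This is the L1
  contraction in discrete form.\<close>

lemma sum_measure_level_sets_diff:
  "(\<Sum>k<m. measure lborel ({x. k < grid_count x} - translate y {x. k < grid_count x}))
     \<le> m * measure lborel (L - translate y L)"
proof -
  have le: "(\<Sum>k<m. 1 * indicator ({x. k < grid_count x} - translate y {x. k < grid_count x}) x)
      \<le> (\<Sum>i<m. 1 * indicator (grid_translate i - translate y (grid_translate i)) x :: real)" for x
  proof -
    have "(\<Sum>k<m. 1 * indicator ({x. k < grid_count x} - translate y {x. k < grid_count x}) x)
        = (\<Sum>k<m. if k < grid_count x then (if k < grid_count (x - y) then 0 else 1) else (0::real))"
      by (intro sum.cong) (auto simp: indicator_def translate_def)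
    also have "\<dots> = (\<Sum>k<grid_count x. if k < grid_count (x - y) then 0 else 1)"
      by (rule sum_level[OF grid_count_le])
    also have "\<dots> = real (grid_count x - grid_count (x - y))"
    proof -
      have "(\<Sum>k<grid_count x. if k < grid_count (x - y) then 0 else (1::real)) = real (card ({..<grid_count x} - {..<grid_count (x-y)}))"
      proof -
        have "{..<grid_count x} - {..<grid_count (x-y)} = {k\<in>{..<grid_count x}. \<not> k < grid_count (x-y)}" by auto
        then show ?thesis
          unfolding card_indicator[OF finite_lessThan, symmetric]
          by (simp only: card_indicator[OF finite_lessThan]) (intro sum.cong refl, simp)
      qed
      also have "card ({..<grid_count x} - {..<grid_count (x-y)}) = grid_count x - grid_count (x - y)"
        unfolding lessThan_minus_lessThan by simp
      finally show ?thesis .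
    qed
    also have "grid_count x - grid_count (x - y) \<le> card ({i\<in>{..<m}. x - (3 * real i / real m) *\<^sub>R v \<in> L} - {i\<in>{..<m}. x - y - (3 * real i / real m) *\<^sub>R v \<in> L})"
      by (rule diff_card_le_card_Diff) auto
    also have "\<dots> = card {i\<in>{..<m}. x \<in> grid_translate i - translate y (grid_translate i)}"
      by (intro arg_cong[where f=card]) (auto simp: translate_def)
    also have "real \<dots> = (\<Sum>i<m. 1 * indicator (grid_translate i - translate y (grid_translate i)) x)"
      unfolding card_indicator[OF finite_lessThan] by (intro sum.cong refl) (simp add: indicator_def)
    finally show ?thesis by simp
  qed
  have "grid_translate i - translate y (grid_translate i) = translate ((3 * real i / real m) *\<^sub>R v) (L - translate y L)" for i
    by (auto simp: translate_def algebra_simps)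
  then have eq: "measure lborel (grid_translate i - translate y (grid_translate i)) = measure lborel (L - translate y L)" for i
    by (simp only: measure_translate sets.Diff L translate_measurable)
  have f1: "emeasure lborel (A - D) < \<infinity>" if "emeasure lborel A < \<infinity>" "A \<in> sets borel" for A D :: "'b set"
    using that by (metis Diff_subset emeasure_mono order_le_less_trans sets_lborel)
  have "(\<Sum>k<m. 1 * measure lborel ({x. k < grid_count x} - translate y {x. k < grid_count x}))
       \<le> (\<Sum>i<m. 1 * measure lborel (grid_translate i - translate y (grid_translate i)))"
    using fin by (intro sum_measure_mono le f1)
      (auto simp only: finite_lessThan level_set_measurable level_set_finite grid_translate_measurable emeasure_translate L
         intro!: sets.Diff translate_measurable)
  then show ?thesis by (simp add: eq)
qed

text \<open>The weights are the increments of c (m - c), the number of pairs of one of the c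
  translates that contain the point and one of the m - c that do not. So the first moment of the
  rearranged parameter is read off from pairwise differences of translates.\<close>

lemma sum_measure_level_sets_moment:
  "(\<Sum>k<m. (real m - 1 - 2 * real k) * measure lborel {x. k < grid_count x})
     = (\<Sum>i<m. \<Sum>i'<m. measure lborel (L - translate ((3 * (real i' - real i) / real m) *\<^sub>R v) L))"
proof -
  have c: "(\<Sum>k<c. (real m - 1 - 2 * real k)) = real c * (real m - real c)" for c :: nat
    by (induction c) (auto simp: algebra_simps)
  have "(\<Sum>k<m. (real m - 1 - 2 * real k) * indicator {x. k < grid_count x} x) = real (grid_count x) * (real m - real (grid_count x))" for x
    unfolding c[symmetric] sum_level[OF grid_count_le, symmetric] by (intro sum.cong) (auto simp: indicator_def)
  also have "real (grid_count x) * (real m - real (grid_count x)) = (\<Sum>i<m. \<Sum>i'<m. indicator (grid_translate i) x * (1 - indicator (grid_translate i') x))" for x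
    unfolding grid_count_eq sum_product[symmetric] by (simp add: sum_subtractf)
  also have "(\<Sum>i<m. \<Sum>i'<m. indicator (grid_translate i) x * (1 - indicator (grid_translate i') x)) =
     (\<Sum>z\<in>{..<m}\<times>{..<m}. 1 * indicator (grid_translate (fst z) - grid_translate (snd z)) x :: real)" for x
    unfolding sum.cartesian_product by (intro sum.cong) (auto simp: indicator_def)
  finally have eq: "(\<Sum>k<m. (real m - 1 - 2 * real k) * indicator {x. k < grid_count x} x) = 
     (\<Sum>z\<in>{..<m}\<times>{..<m}. 1 * indicator (grid_translate (fst z) - grid_translate (snd z)) x)" for x .
  have f1: "emeasure lborel (A - D) < \<infinity>" if "emeasure lborel A < \<infinity>" "A \<in> sets borel" for A D :: "'b set"
    using that by (metis Diff_subset emeasure_mono order_le_less_trans sets_lborel)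
  have "(\<Sum>k<m. (real m - 1 - 2 * real k) * measure lborel {x. k < grid_count x}) =
     (\<Sum>z\<in>{..<m}\<times>{..<m}. 1 * measure lborel (grid_translate (fst z) - grid_translate (snd z)))"
    using fin by (intro antisym sum_measure_mono f1)
      (auto simp only: eq finite_lessThan level_set_measurable level_set_finite grid_translate_measurable emeasure_translate L
         intro!: sets.Diff translate_measurable f1 finite_cartesian_product)
  also have "\<dots> = (\<Sum>i<m. \<Sum>i'<m. measure lborel (grid_translate i - grid_translate i'))"
    unfolding sum.cartesian_product by (intro sum.cong) auto
  also have "\<dots> = (\<Sum>i<m. \<Sum>i'<m. measure lborel (L - translate ((3 * (real i' - real i) / real m) *\<^sub>R v) L))"
    unfolding translate_diff_translate
    by (intro sum.cong refl) (subst measure_translate, simp_all add: L translate_measurable scaleR_diff_left[symmetric] diff_divide_distrib right_diff_distrib sets.Diff)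
  finally show ?thesis .
qed

end

lemma rearranged_measurable_finite:
  fixes B :: "'b::euclidean_space set"
  assumes "B \<in> sets borel" "emeasure lborel B < \<infinity>"
  shows "rearranged m B vs ks \<in> sets borel \<and> emeasure lborel (rearranged m B vs ks) < \<infinity>"
  using assms
proof (induction m B vs ks rule: rearranged.induct)
  case (1 m B v vs k ks)
  then have L: "rearranged m B vs ks \<in> sets borel" "emeasure lborel (rearranged m B vs ks) < \<infinity>" by auto
  show ?case unfolding rearranged.simps
    using level_set_measurable[OF L] level_set_finite[OF L] by blast
qed auto

section \<open>Iterated rearrangement and its barycentre\<close>

definition index_lists :: "nat \<Rightarrow> nat \<Rightarrow> nat list set" where
  "index_lists m n = {ks. set ks \<subseteq> {..<m} \<and> length ks = n}"

lemma finite_index_lists [simp]: "finite (index_lists m n)"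
  unfolding index_lists_def by (rule finite_lists_length_eq) simp

lemma sum_index_lists_0 [simp]: "(\<Sum>ks\<in>index_lists m 0. g ks) = g []"
proof -
  have "index_lists m 0 = {[]}" by (auto simp: index_lists_def)
  then show ?thesis by simp
qed

lemma card_index_lists_0 [simp]: "card (index_lists m 0) = Suc 0"
  using sum_index_lists_0[of "\<lambda>_. 1::nat" m] by simp

lemma sum_index_lists_Suc:
  "(\<Sum>ks\<in>index_lists m (Suc n). g ks) = (\<Sum>ks\<in>index_lists m n. \<Sum>k<m. g (k # ks))"
proof -
  have "index_lists m (Suc n) = (\<lambda>(ks, k). k # ks) ` (index_lists m n \<times> {..<m})"
    unfolding index_lists_def lists_length_Suc_eq by simp
  moreover have "inj_on (\<lambda>(ks, k). k # ks) (index_lists m n \<times> {..<m})"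
    by (auto simp: inj_on_def)
  ultimately have "(\<Sum>ks\<in>index_lists m (Suc n). g ks) = (\<Sum>(ks, k)\<in>index_lists m n \<times> {..<m}. g (k # ks))"
    by (simp add: sum.reindex case_prod_unfold)
  then show ?thesis by (simp add: sum.cartesian_product)
qed

context
  fixes m :: nat and B :: "'b::euclidean_space set"
  assumes B: "B \<in> sets borel" and fin: "emeasure lborel B < \<infinity>"
begin

lemmas rearranged_measurable = rearranged_measurable_finite[OF B fin, THEN conjunct1] rearranged_measurable_finite[OF B fin, THEN conjunct2]

lemma sum_measure_rearranged:
  "(\<Sum>ks\<in>index_lists m (length vs). measure lborel (rearranged m B vs ks)) = real m ^ length vs * measure lborel B"
proof (induction vs)
  case (Cons v vs)
  have "(\<Sum>ks\<in>index_lists m (length (v # vs)). measure lborel (rearranged m B (v # vs) ks))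
     = (\<Sum>ks\<in>index_lists m (length vs). real m * measure lborel (rearranged m B vs ks))"
    unfolding list.size add_Suc_right add_0_right sum_index_lists_Suc rearranged.simps
    by (intro sum.cong refl sum_measure_level_sets rearranged_measurable)
  then show ?case using Cons by (simp add: sum_distrib_left[symmetric])
qed simp

lemma sum_measure_rearranged_diff:
  "(\<Sum>ks\<in>index_lists m (length vs). measure lborel (rearranged m B vs ks - translate y (rearranged m B vs ks)))
     \<le> real m ^ length vs * measure lborel (B - translate y B)"
proof (induction vs)
  case (Cons v vs)
  have "(\<Sum>ks\<in>index_lists m (length (v # vs)). measure lborel (rearranged m B (v # vs) ks - translate y (rearranged m B (v # vs) ks)))
     \<le> (\<Sum>ks\<in>index_lists m (length vs). real m * measure lborel (rearranged m B vs ks - translate y (rearranged m B vs ks)))"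
    unfolding list.size add_Suc_right add_0_right sum_index_lists_Suc rearranged.simps
    by (intro sum_mono sum_measure_level_sets_diff rearranged_measurable)
  also have "\<dots> \<le> real m * (real m ^ length vs * measure lborel (B - translate y B))"
    unfolding sum_distrib_left[symmetric] using Cons by (intro mult_left_mono) auto
  finally show ?case by simp
qed simp

text \<open>For the subgraph of a probability density, this is m^2 times the expected total
  variation distance between translates at two independent uniform grid parameters.\<close>

definition spread :: "'b \<Rightarrow> real" where
  "spread v = (\<Sum>i<m. \<Sum>i'<m. measure lborel (B - translate ((3 * (real i' - real i) / real m) *\<^sub>R v) B))"

text \<open>The head of the list is rearranged last. Its moment equals a sum of differences of
  translates of already rearranged sets, which by contraction is at most that of the original set. A
  later list entry keeps its moment bound because summing over the head parameter multiplies every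
  measure by m.\<close>

lemma sum_measure_rearranged_moment:
  assumes "j < length vs"
  shows "real m * (\<Sum>ks\<in>index_lists m (length vs). (real m - 1 - 2 * real (ks ! j)) * measure lborel (rearranged m B vs ks))
     \<le> real m ^ length vs * spread (vs ! j)"
  using assms
proof (induction vs arbitrary: j)
  case (Cons v vs)
  show ?case
  proof (cases j)
    case 0
    have "(\<Sum>ks\<in>index_lists m (length (v # vs)). (real m - 1 - 2 * real (ks ! j)) * measure lborel (rearranged m B (v # vs) ks))
      = (\<Sum>ks\<in>index_lists m (length vs). \<Sum>i<m. \<Sum>i'<m. measure lborel (rearranged m B vs ks - translate ((3 * (real i' - real i) / real m) *\<^sub>R v) (rearranged m B vs ks)))"
      unfolding list.size add_Suc_right add_0_right sum_index_lists_Suc rearranged.simps 0 nth_Cons_0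
      by (intro sum.cong refl sum_measure_level_sets_moment rearranged_measurable)
    also have "\<dots> = (\<Sum>i<m. \<Sum>i'<m. \<Sum>ks\<in>index_lists m (length vs). measure lborel (rearranged m B vs ks - translate ((3 * (real i' - real i) / real m) *\<^sub>R v) (rearranged m B vs ks)))"
      by (subst sum.swap, intro sum.cong refl, rule sum.swap)
    also have "\<dots> \<le> (\<Sum>i<m. \<Sum>i'<m. real m ^ length vs * measure lborel (B - translate ((3 * (real i' - real i) / real m) *\<^sub>R v) B))"
      by (intro sum_mono sum_measure_rearranged_diff)
    also have "\<dots> = real m ^ length vs * spread v"
      by (simp add: spread_def sum_distrib_left)
    finally show ?thesis by (simp add: 0 mult.assoc mult_left_mono)
  next
    case (Suc j')
    have "(\<Sum>ks\<in>index_lists m (length (v # vs)). (real m - 1 - 2 * real (ks ! j)) * measure lborel (rearranged m B (v # vs) ks))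
      = (\<Sum>ks\<in>index_lists m (length vs). (real m - 1 - 2 * real (ks ! j')) * (real m * measure lborel (rearranged m B vs ks)))"
      unfolding list.size add_Suc_right add_0_right sum_index_lists_Suc rearranged.simps Suc nth_Cons_Suc sum_distrib_left[symmetric]
      by (intro sum.cong refl arg_cong2[where f="(*)"] sum_measure_level_sets rearranged_measurable)
    also have "\<dots> = real m * (\<Sum>ks\<in>index_lists m (length vs). (real m - 1 - 2 * real (ks ! j')) * measure lborel (rearranged m B vs ks))"
      by (simp add: sum_distrib_left algebra_simps)
    also have "\<dots> \<le> real m ^ length vs * spread (vs ! j')"
      using Cons by (simp add: Suc)
    finally show ?thesis by (simp add: Suc mult.assoc mult_left_mono)
  qed
qed simp

text \<open>The bound on \<open>spread\<close> makes every parameter of the barycentre at least 1.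
  There m^2/3 is the threshold 1/3 for the expected distance, and -m makes up for the grid, whose
  indices have mean (m - 1)/2 rather than m/2.\<close>

theorem signed_sum_in_difference_body:
  assumes "0 < m" "convex H" "B \<subseteq> H" "0 < measure lborel B"
    and spread: "\<And>v. v \<in> set vs \<Longrightarrow> spread v \<le> ((real m)\<^sup>2 / 3 - real m) * measure lborel B"
  shows "\<exists>e p q. (\<forall>j. e j \<in> {-1, 1::real}) \<and> p \<in> H \<and> q \<in> H \<and>
     p - q = (\<Sum>j<length vs. e j *\<^sub>R vs ! j)"
proof -
  define \<mu> where "\<mu> ks = measure lborel (rearranged m B vs ks)" for ks
  define M where "M = real m ^ length vs * measure lborel B"
  have M: "0 < M" using assms by (simp add: M_def)
  have sumM: "(\<Sum>ks\<in>index_lists m (length vs). \<mu> ks) = M"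
    by (simp add: \<mu>_def M_def sum_measure_rearranged)
  define I where "I = {ks\<in>index_lists m (length vs). \<mu> ks \<noteq> 0}"
  have sumI: "(\<Sum>ks\<in>I. g ks * (\<mu> ks / M)) = (\<Sum>ks\<in>index_lists m (length vs). g ks * \<mu> ks) / M" for g
    unfolding sum_divide_distrib I_def by (intro sum.mono_neutral_cong_left) auto
  \<comment> \<open>One arbitrary point represents each section of nonzero measure: the parameters
    are constant on a section, and they are what has to be averaged.\<close>
  have "\<forall>ks\<in>I. \<exists>x. x \<in> rearranged m B vs ks"
    unfolding I_def \<mu>_def by (metis (mono_tags, lifting) all_not_in_conv measure_empty mem_Collect_eq)
  then obtain x where x: "\<And>ks. ks \<in> I \<Longrightarrow> x ks \<in> rearranged m B vs ks" by metis
  define l where "l j = (\<Sum>ks\<in>I. \<mu> ks / M * (3 * real (ks ! j) / real m))" for j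
  have "reach H vs l (\<Sum>ks\<in>I. (\<mu> ks / M) *\<^sub>R x ks)"
    unfolding l_def
  proof (rule reach_convex_combination)
    show "(\<Sum>ks\<in>I. \<mu> ks / M) = 1"
      using sumI[of "\<lambda>_. 1"] M by (simp add: sumM)
    show "reach H vs (\<lambda>j. 3 * real (ks ! j) / real m) (x ks)" if "ks \<in> I" for ks
      using assms(3) x[OF that] that by (intro rearranged_imp_reach) (auto simp: I_def index_lists_def)
  qed (use M in \<open>auto simp: I_def \<mu>_def assms(2)\<close>)
  moreover have "1 \<le> l j" if "j < length vs" for j
  proof -
    define S where "S = (\<Sum>ks\<in>index_lists m (length vs). real (ks ! j) * \<mu> ks)"
    have "real m * (\<Sum>ks\<in>index_lists m (length vs). (real m - 1 - 2 * real (ks ! j)) * \<mu> ks)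
        \<le> real m ^ length vs * spread (vs ! j)"
      unfolding \<mu>_def using that by (rule sum_measure_rearranged_moment)
    also have "\<dots> \<le> real m ^ length vs * (((real m)\<^sup>2 / 3 - real m) * measure lborel B)"
      using that by (intro mult_left_mono spread) auto
    also have "(\<Sum>ks\<in>index_lists m (length vs). (real m - 1 - 2 * real (ks ! j)) * \<mu> ks) = (real m - 1) * M - 2 * S"
      by (simp add: left_diff_distrib sum_subtractf sum_distrib_left[symmetric] sumM S_def mult.assoc)
    finally have "real m * ((real m - 1) * M - 2 * S) \<le> real m * ((real m / 3 - 1) * M)"
      by (simp add: M_def power2_eq_square algebra_simps)
    then have "(real m - 1) * M - 2 * S \<le> (real m / 3 - 1) * M"
      using assms(1) by simp
    then have "real m * M \<le> 3 * S" by (simp add: algebra_simps)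
    moreover have "l j = 3 * S / (real m * M)"
    proof -
      have "l j = (3 / real m) * (\<Sum>ks\<in>I. real (ks ! j) * (\<mu> ks / M))"
        unfolding l_def sum_distrib_left by (intro sum.cong refl) (simp add: mult_ac)
      also have "\<dots> = 3 * S / (real m * M)"
        unfolding sumI S_def by simp
      finally show ?thesis .
    qed
    ultimately show ?thesis using M assms(1) by (simp add: mult.commute)
  qed
  \<comment> \<open>Both starting points are the barycentre, so their difference drops out and only
    the signed sum remains.\<close>
  ultimately show ?thesis
    using reach_imp_signed_sum[OF assms(2), of vs l l "\<Sum>ks\<in>I. (\<mu> ks / M) *\<^sub>R x ks" "\<Sum>ks\<in>I. (\<mu> ks / M) *\<^sub>R x ks"]
    by (simp only: diff_self add_0_left)
qed

end

section \<open>Gaussian integrals\<close>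

definition gauss_int :: "real \<Rightarrow> real" where
  "gauss_int x = (LBINT z=0..x. exp (- z\<^sup>2 / 2))"

lemma gauss_int_0 [simp]: "gauss_int 0 = 0"
  unfolding gauss_int_def zero_ereal_def by (rule interval_integral_endpoints_same)

lemma DERIV_gauss_int [derivative_intros]:
  "(gauss_int has_real_derivative exp (- x\<^sup>2 / 2)) (at x)"
proof -
  define R where "R = \<bar>x\<bar> + 1"
  have "((\<lambda>u. LBINT z=0..u. exp (- z\<^sup>2 / 2)) has_vector_derivative exp (- x\<^sup>2 / 2)) (at x within {-R..R})"
    unfolding zero_ereal_def
    by (rule interval_integral_FTC2) (auto simp: R_def intro!: continuous_intros)
  then have "(gauss_int has_vector_derivative exp (- x\<^sup>2 / 2)) (at x within {-R<..<R})"
    unfolding gauss_int_def[abs_def] zero_ereal_def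
    by (rule has_vector_derivative_within_subset) auto
  then show ?thesis
    by (subst (asm) at_within_open) (auto simp: R_def has_real_derivative_iff_has_vector_derivative)
qed

lemma gauss_int_minus: "gauss_int (- x) = - gauss_int x"
proof -
  have "((\<lambda>x. gauss_int (- x) + gauss_int x) has_real_derivative 0) (at x)" for x
    by (auto intro!: derivative_eq_intros DERIV_chain2[OF DERIV_gauss_int])
  then have "\<exists>c. \<forall>x\<in>UNIV. gauss_int (- x) + gauss_int x = c"
    by (intro has_field_derivative_zero_constant) auto
  then obtain c where c: "\<And>x. gauss_int (- x) + gauss_int x = c" by auto
  from c[of 0] c[of x] show ?thesis by simp
qed

lemma has_bochner_integral_half_gaussian:
  "has_bochner_integral lborel (\<lambda>x. indicator {0..} x *\<^sub>R exp (- x\<^sup>2 / 2)) (sqrt (pi / 2))"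
proof -
  have "has_bochner_integral lborel (\<lambda>x. indicator {0..} (0 + (1 / sqrt 2) * x) *\<^sub>R exp (- (0 + (1 / sqrt 2) * x)\<^sup>2)) ((sqrt pi / 2) /\<^sub>R \<bar>1 / sqrt 2\<bar>)"
    using lborel_has_bochner_integral_real_affine_iff[of "1 / sqrt 2" "\<lambda>x. indicator {0..} x *\<^sub>R exp (- x\<^sup>2)" "sqrt pi / 2" 0] gaussian_moment_0
    by simp
  moreover have "indicator {0..} (0 + (1 / sqrt 2) * x) *\<^sub>R exp (- (0 + (1 / sqrt 2) * x)\<^sup>2) = indicator {0..} x *\<^sub>R exp (- x\<^sup>2 / 2)" for x :: real
    by (auto simp: indicator_def power_divide zero_le_divide_iff)
  moreover have "(sqrt pi / 2) /\<^sub>R \<bar>1 / sqrt 2\<bar> = sqrt (pi / 2)"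
    by (simp add: real_sqrt_divide field_simps)
  ultimately show ?thesis by (simp only:)
qed

lemma gauss_int_at_top: "(gauss_int \<longlongrightarrow> sqrt (pi / 2)) at_top"
proof -
  have int: "integrable lborel (\<lambda>x. indicator {0..} x *\<^sub>R exp (- x\<^sup>2 / 2) :: real)"
    and val: "(\<integral>x. indicator {0..} x *\<^sub>R exp (- x\<^sup>2 / 2) \<partial>lborel) = sqrt (pi / 2)"
    using has_bochner_integral_half_gaussian unfolding has_bochner_integral_iff by auto
  have "((\<lambda>y. \<integral>x. indicator {..y} x *\<^sub>R (indicator {0..} x *\<^sub>R exp (- x\<^sup>2 / 2)) \<partial>lborel) \<longlongrightarrow> sqrt (pi / 2)) at_top"
    using tendsto_integral_at_top[OF _ int] unfolding val by simp
  moreover have "\<forall>\<^sub>F y in at_top. (\<integral>x. indicator {..y} x *\<^sub>R (indicator {0..} x *\<^sub>R exp (- x\<^sup>2 / 2)) \<partial>lborel) = gauss_int y"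
    using eventually_ge_at_top[of 0]
  proof eventually_elim
    case (elim y)
    have "gauss_int y = (LBINT x:{0..y}. exp (- x\<^sup>2 / 2))"
      unfolding gauss_int_def zero_ereal_def using elim by (rule interval_integral_Icc)
    also have "\<dots> = (\<integral>x. indicator {..y} x *\<^sub>R (indicator {0..} x *\<^sub>R exp (- x\<^sup>2 / 2)) \<partial>lborel)"
      unfolding set_lebesgue_integral_def
      by (intro Bochner_Integration.integral_cong refl) (auto simp: indicator_def)
    finally show ?case by simp
  qed
  ultimately show ?thesis by (rule Lim_transform_eventually)
qed

lemma gauss_int_at_bot: "(gauss_int \<longlongrightarrow> - sqrt (pi / 2)) at_bot"
proof -
  have "((\<lambda>x. - gauss_int (- x)) \<longlongrightarrow> - sqrt (pi / 2)) at_bot"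
    by (intro tendsto_minus filterlim_compose[OF gauss_int_at_top] filterlim_uminus_at_top_at_bot)
  then show ?thesis by (simp add: gauss_int_minus)
qed

section \<open>Gaussian mixtures and integrals against the Cauchy kernel\<close>

lemma has_bochner_integral_gaussian_cos:
  "has_bochner_integral lborel (\<lambda>x. cos (s * x) * exp (- x\<^sup>2 / 2)) (sqrt (2 * pi) * exp (- s\<^sup>2 / 2))"
proof -
  interpret real_distribution std_normal_distribution by (rule real_dist_normal_dist)
  have int: "integrable std_normal_distribution (\<lambda>x. iexp (s * x))"
    by (rule integrable_iexp) auto
  have "complex_of_real (exp (- s\<^sup>2 / 2)) = (CLINT x|std_normal_distribution. iexp (s * x))"
    using char_std_normal_distribution by (simp add: char_def fun_eq_iff)
  then have "exp (- s\<^sup>2 / 2) = Re (CLINT x|std_normal_distribution. iexp (s * x))"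
    by (metis Re_complex_of_real)
  also have "\<dots> = (\<integral>x. cos (s * x) \<partial>std_normal_distribution)"
    by (subst integral_Re[OF int, symmetric]) (simp add: Re_exp)
  also have "\<dots> = (\<integral>x. std_normal_density x * cos (s * x) \<partial>lborel)"
    by (subst integral_density) auto
  finally have val: "(\<integral>x. std_normal_density x * cos (s * x) \<partial>lborel) = exp (- s\<^sup>2 / 2)" by simp
  have "integrable std_normal_distribution (\<lambda>x. cos (s * x))"
    using integrable_Re[OF int] by (simp add: Re_exp)
  then have "integrable lborel (\<lambda>x. std_normal_density x * cos (s * x))"
    by (subst (asm) integrable_density) auto
  then have "has_bochner_integral lborel (\<lambda>x. std_normal_density x * cos (s * x)) (exp (- s\<^sup>2 / 2))"
    using val by (simp add: has_bochner_integral_iff)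
  then have "has_bochner_integral lborel (\<lambda>x. sqrt (2 * pi) * (std_normal_density x * cos (s * x))) (sqrt (2 * pi) * exp (- s\<^sup>2 / 2))"
    by (rule has_bochner_integral_mult_right)
  moreover have "sqrt (2 * pi) * (std_normal_density x * cos (s * x)) = cos (s * x) * exp (- x\<^sup>2 / 2)" for x
    by (simp add: std_normal_density_def)
  ultimately show ?thesis by (simp only:)
qed

lemma has_bochner_integral_scaled_gaussian_cos:
  assumes "0 < z"
  shows "has_bochner_integral lborel (\<lambda>t. cos (t * y) * exp (- (z * t)\<^sup>2 / 2)) (sqrt (2 * pi) / z * exp (- (y / z)\<^sup>2 / 2))"
proof -
  have "has_bochner_integral lborel (\<lambda>t. cos (y / z * (0 + z * t)) * exp (- (0 + z * t)\<^sup>2 / 2)) ((sqrt (2 * pi) * exp (- (y / z)\<^sup>2 / 2)) /\<^sub>R \<bar>z\<bar>)"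
    using lborel_has_bochner_integral_real_affine_iff[of z "\<lambda>x. cos (y / z * x) * exp (- x\<^sup>2 / 2)" _ 0]
      has_bochner_integral_gaussian_cos[of "y / z"] assms by simp
  then show ?thesis using assms by (simp add: field_simps)
qed

text \<open>With c = 1 + t^2 this writes 1 / (1 + t^2) as a mixture of centred Gaussians in t, so
  that integrals against the Cauchy kernel become Gaussian ones.\<close>

lemma has_bochner_integral_linear_gaussian:
  fixes c :: real
  assumes "0 < c"
  shows "has_bochner_integral lborel (\<lambda>z. indicator {0<..} z * (z * exp (- (c * z\<^sup>2 / 2)))) (1 / c)"
proof -
  have lim: "((\<lambda>z. - exp (- (c * z\<^sup>2 / 2)) / c) \<longlongrightarrow> 0) at_top"
    using assms by real_asymp
  have "((\<lambda>z. - exp (- (c * z\<^sup>2 / 2)) / c) \<longlongrightarrow> - exp (- (c * 0\<^sup>2 / 2)) / c) (at_right 0)"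
    by (intro tendsto_intros) (use assms in auto)
  then have "((\<lambda>z. - exp (- (c * z\<^sup>2 / 2)) / c) \<longlongrightarrow> - 1 / c) (at_right 0)" by simp
  note FTC = interval_integral_FTC_nonneg[where a=0 and b=\<infinity> and F="\<lambda>z. - exp (- (c * z\<^sup>2 / 2)) / c" and f="\<lambda>z. z * exp (- (c * z\<^sup>2 / 2))" and A="- 1 / c" and B=0]
  have "set_integrable lborel (einterval 0 \<infinity>) (\<lambda>z. z * exp (- (c * z\<^sup>2 / 2)))"
       "(LBINT z=0..\<infinity>. z * exp (- (c * z\<^sup>2 / 2))) = 0 - (- 1 / c)"
    using \<open>((\<lambda>z. - exp (- (c * z\<^sup>2 / 2)) / c) \<longlongrightarrow> - 1 / c) (at_right 0)\<close> lim assms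
    by (intro FTC; auto simp: zero_ereal_def ereal_tendsto_simps1 ereal_tendsto_simps2
       intro!: derivative_eq_intros continuous_intros AE_I2)+
  moreover have "einterval 0 \<infinity> = {0<..}"
    by (auto simp: einterval_def zero_ereal_def)
  ultimately show ?thesis
    by (simp add: has_bochner_integral_iff set_integrable_def interval_lebesgue_integral_def set_lebesgue_integral_def)
qed

text \<open>The squares of z + a/z and z - a/z differ from z^2 + (a/z)^2 by 2a and -2a, so the
  prefactors exp a and exp (-a) give both terms of F the same exponential after differentiation,
  while the inner derivatives 1 - a/z^2 and 1 + a/z^2 add up to 2.\<close>

lemma has_bochner_integral_glasser:
  assumes "0 \<le> a"
  shows "has_bochner_integral lborel (\<lambda>z. indicator {0<..} z * exp (- z\<^sup>2 / 2 - (a / z)\<^sup>2 / 2)) (sqrt (pi / 2) * exp (- a))"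
proof -
  define F where "F z = (exp a * gauss_int (z + a / z) + exp (- a) * gauss_int (z - a / z)) / 2" for z
  have der: "DERIV F z :> exp (- z\<^sup>2 / 2 - (a / z)\<^sup>2 / 2)" if "0 < z" for z
  proof -
    have e1: "exp a * exp (- (z + a / z)\<^sup>2 / 2) = exp (- z\<^sup>2 / 2 - (a / z)\<^sup>2 / 2)"
      using that by (simp add: exp_add[symmetric] power2_eq_square field_simps)
    have e2: "exp (- a) * exp (- (z - a / z)\<^sup>2 / 2) = exp (- z\<^sup>2 / 2 - (a / z)\<^sup>2 / 2)"
      using that by (simp add: exp_add[symmetric] power2_eq_square field_simps)
    have d1: "((\<lambda>z. gauss_int (z + a / z)) has_real_derivative exp (- (z + a / z)\<^sup>2 / 2) * (1 - a / z\<^sup>2)) (at z)"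
      using that by (intro DERIV_chain2[OF DERIV_gauss_int]) (auto intro!: derivative_eq_intros simp: power2_eq_square)
    have d2: "((\<lambda>z. gauss_int (z - a / z)) has_real_derivative exp (- (z - a / z)\<^sup>2 / 2) * (1 + a / z\<^sup>2)) (at z)"
      using that by (intro DERIV_chain2[OF DERIV_gauss_int]) (auto intro!: derivative_eq_intros simp: power2_eq_square)
    have "DERIV F z :> (exp a * (exp (- (z + a / z)\<^sup>2 / 2) * (1 - a / z\<^sup>2)) + exp (- a) * (exp (- (z - a / z)\<^sup>2 / 2) * (1 + a / z\<^sup>2))) / 2"
      unfolding F_def[abs_def] by (intro DERIV_cdivide DERIV_add DERIV_cmult d1 d2)
    also have "(exp a * (exp (- (z + a / z)\<^sup>2 / 2) * (1 - a / z\<^sup>2)) + exp (- a) * (exp (- (z - a / z)\<^sup>2 / 2) * (1 + a / z\<^sup>2))) / 2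
       = exp (- z\<^sup>2 / 2 - (a / z)\<^sup>2 / 2)"
      unfolding mult.assoc[symmetric] e1 e2 by (simp add: algebra_simps)
    finally show ?thesis .
  qed
  have top: "(F \<longlongrightarrow> (exp a * sqrt (pi / 2) + exp (- a) * sqrt (pi / 2)) / 2) at_top"
  proof -
    have "filterlim (\<lambda>z::real. z + a / z) at_top at_top" "filterlim (\<lambda>z::real. z - a / z) at_top at_top"
      by real_asymp+
    then show ?thesis unfolding F_def
      by (intro tendsto_intros filterlim_compose[OF gauss_int_at_top]) auto
  qed
  \<comment> \<open>As z tends to 0, z - a/z tends to minus infinity and z + a/z to infinity if a is
    positive, but both tend to 0 if a = 0; hence two limits.\<close>
  define A where "A = (if a = 0 then 0 else (exp a * sqrt (pi / 2) + exp (- a) * (- sqrt (pi / 2))) / 2)"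
  have bot: "(F \<longlongrightarrow> A) (at_right 0)"
  proof (cases "a = 0")
    case True
    have "(gauss_int \<longlongrightarrow> gauss_int 0) (at_right 0)"
      using DERIV_isCont[OF DERIV_gauss_int, of 0] by (simp add: isCont_def filterlim_at_split)
    moreover have "F = gauss_int" by (simp add: F_def True fun_eq_iff)
    ultimately show ?thesis by (simp add: A_def True)
  next
    case False
    then have "0 < a" using assms by simp
    then have "filterlim (\<lambda>z::real. z + a / z) at_top (at_right 0)" "filterlim (\<lambda>z::real. z - a / z) at_bot (at_right 0)"
      by real_asymp+
    then have "(F \<longlongrightarrow> (exp a * sqrt (pi / 2) + exp (- a) * (- sqrt (pi / 2))) / 2) (at_right 0)"
      unfolding F_def
      by (intro tendsto_intros filterlim_compose[OF gauss_int_at_top] filterlim_compose[OF gauss_int_at_bot]) auto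
    then show ?thesis using False by (simp add: A_def)
  qed
  note FTC = interval_integral_FTC_nonneg[where a=0 and b=\<infinity> and F=F and f="\<lambda>z. exp (- z\<^sup>2 / 2 - (a / z)\<^sup>2 / 2)"]
  have "set_integrable lborel (einterval 0 \<infinity>) (\<lambda>z. exp (- z\<^sup>2 / 2 - (a / z)\<^sup>2 / 2))"
       "(LBINT z=0..\<infinity>. exp (- z\<^sup>2 / 2 - (a / z)\<^sup>2 / 2)) = (exp a * sqrt (pi / 2) + exp (- a) * sqrt (pi / 2)) / 2 - A"
    using bot top der
    by (intro FTC; auto simp: zero_ereal_def ereal_tendsto_simps1 ereal_tendsto_simps2
       intro!: continuous_intros AE_I2)+
  moreover have "einterval 0 \<infinity> = {0<..}"
    by (auto simp: einterval_def zero_ereal_def)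
  moreover have "(exp a * sqrt (pi / 2) + exp (- a) * sqrt (pi / 2)) / 2 - A = sqrt (pi / 2) * exp (- a)"
    by (auto simp: A_def field_simps)
  ultimately show ?thesis
    by (simp add: has_bochner_integral_iff set_integrable_def interval_lebesgue_integral_def set_lebesgue_integral_def)
qed


lemma has_bochner_integral_inverse_1_plus_square:
  "has_bochner_integral lborel (\<lambda>x. 1 / (1 + x\<^sup>2)) pi"
  using integrable_inverse_1_plus_square LBINT_inverse_1_plus_square
  by (simp add: has_bochner_integral_iff set_integrable_def interval_lebesgue_integral_def
    set_lebesgue_integral_def einterval_def inverse_eq_divide)

text \<open>Subordination: with the Cauchy kernel written as a Gaussian mixture, integrating over t
  first leaves the integral of \<open>has_bochner_integral_glasser\<close> for the absolute value of
  y. Fubini applies since dropping the cosine leaves a double integral equal to pi.\<close>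

lemma has_bochner_integral_cauchy_cos:
  "has_bochner_integral lborel (\<lambda>t. cos (t * y) / (1 + t\<^sup>2)) (pi * exp (- \<bar>y\<bar>))"
proof -
  define g where "g t z = indicator {0<..} z * (z * exp (- ((1 + t\<^sup>2) * z\<^sup>2 / 2)))" for t z :: real
  have g: "has_bochner_integral lborel (g t) (1 / (1 + t\<^sup>2))" for t
    unfolding g_def by (rule has_bochner_integral_linear_gaussian) (simp add: add_pos_nonneg)
  have g0: "0 \<le> g t z" for t z by (simp add: g_def indicator_def)
  define f where "f t z = cos (t * y) * g t z" for t z
  have f: "has_bochner_integral lborel (f t) (cos (t * y) / (1 + t\<^sup>2))" for t
    using has_bochner_integral_mult_right[OF g[of t], of "cos (t * y)"] by (simp add: f_def[abs_def])
  have meas: "case_prod g \<in> borel_measurable (lborel \<Otimes>\<^sub>M lborel)"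
    unfolding g_def[abs_def] by measurable
  then have measf: "case_prod f \<in> borel_measurable (lborel \<Otimes>\<^sub>M lborel)"
    unfolding f_def[abs_def] by measurable
  have intg: "integrable (lborel \<Otimes>\<^sub>M lborel) (case_prod g)"
  proof (rule lborel_pair.Fubini_integrable[OF meas])
    have "(\<integral>z. norm (case (t, z) of (t, z) \<Rightarrow> g t z) \<partial>lborel) = 1 / (1 + t\<^sup>2)" for t
      using has_bochner_integral_integral_eq[OF g[of t]] g0 by simp
    then show "integrable lborel (\<lambda>t. \<integral>z. norm (case (t, z) of (t, z) \<Rightarrow> g t z) \<partial>lborel)"
      using has_bochner_integral_inverse_1_plus_square by (simp add: has_bochner_integral_iff)
    show "AE t in lborel. integrable lborel (\<lambda>z. case (t, z) of (t, z) \<Rightarrow> g t z)"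
      using g by (auto simp: has_bochner_integral_iff intro!: AE_I2)
  qed
  have "integrable (lborel \<Otimes>\<^sub>M lborel) (case_prod f)"
    by (rule Bochner_Integration.integrable_bound[OF intg measf])
       (auto simp: f_def abs_mult g0 intro!: AE_I2 mult_left_le_one_le)
  then have fub: "(\<integral>z. (\<integral>t. f t z \<partial>lborel) \<partial>lborel) = (\<integral>t. (\<integral>z. f t z \<partial>lborel) \<partial>lborel)"
    by (rule lborel_pair.Fubini_integral)
  have "(\<integral>t. f t z \<partial>lborel) = sqrt (2 * pi) * (indicator {0<..} z * exp (- z\<^sup>2 / 2 - (\<bar>y\<bar> / z)\<^sup>2 / 2))" for z
  proof (cases "0 < z")
    case True
    have "(\<integral>t. f t z \<partial>lborel) = (\<integral>t. (z * exp (- z\<^sup>2 / 2)) * (cos (t * y) * exp (- (z * t)\<^sup>2 / 2)) \<partial>lborel)"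
      using True by (intro Bochner_Integration.integral_cong refl)
        (simp add: f_def g_def mult_exp_exp power_mult_distrib, simp add: algebra_simps add_divide_distrib)
    also have "\<dots> = (z * exp (- z\<^sup>2 / 2)) * (sqrt (2 * pi) / z * exp (- (y / z)\<^sup>2 / 2))"
      using has_bochner_integral_integral_eq[OF has_bochner_integral_scaled_gaussian_cos[OF True, of y]] by simp
    also have "\<dots> = sqrt (2 * pi) * exp (- z\<^sup>2 / 2 - (\<bar>y\<bar> / z)\<^sup>2 / 2)"
      using True by (simp add: mult.left_commute[of "exp _"] mult_exp_exp power_divide)
    finally show ?thesis using True by simp
  qed (simp add: f_def g_def)
  then have "(\<integral>z. (\<integral>t. f t z \<partial>lborel) \<partial>lborel) = sqrt (2 * pi) * (sqrt (pi / 2) * exp (- \<bar>y\<bar>))"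
    using has_bochner_integral_integral_eq[OF has_bochner_integral_glasser[of "\<bar>y\<bar>"]] by simp
  also have "\<dots> = pi * exp (- \<bar>y\<bar>)"
    by (simp add: real_sqrt_mult[symmetric] mult.assoc[symmetric])
  finally have "(\<integral>t. cos (t * y) / (1 + t\<^sup>2) \<partial>lborel) = pi * exp (- \<bar>y\<bar>)"
    using fub has_bochner_integral_integral_eq[OF f] by simp
  moreover have "integrable lborel (\<lambda>t. cos (t * y) / (1 + t\<^sup>2))"
  proof (rule Bochner_Integration.integrable_bound)
    show "integrable lborel (\<lambda>t. 1 / (1 + t\<^sup>2) :: real)"
      using has_bochner_integral_inverse_1_plus_square by (simp add: has_bochner_integral_iff)
    show "AE t in lborel. norm (cos (t * y) / (1 + t\<^sup>2)) \<le> norm (1 / (1 + t\<^sup>2))"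
      by (intro AE_I2) (auto simp: abs_divide intro!: divide_right_mono)
  qed measurable
  ultimately show ?thesis by (simp add: has_bochner_integral_iff)
qed

text \<open>The same mixture truncated at z < r produces one minus the exponential in the numerator.
  Divided by pi, the value is the overlap of the unit normal laws with means r and -r, the benchmark
  for the product density.\<close>

lemma has_bochner_integral_cauchy_gaussian:
  assumes "0 \<le> r"
  shows "has_bochner_integral lborel (\<lambda>t. exp (- ((1 + t\<^sup>2) * r\<^sup>2 / 2)) / (1 + t\<^sup>2)) (pi - sqrt (2 * pi) * gauss_int r)"
proof -
  define g where "g t z = indicator {0<..<r} z * (z * exp (- ((1 + t\<^sup>2) * z\<^sup>2 / 2)))" for t z :: real
  have g: "has_bochner_integral lborel (g t) ((1 - exp (- ((1 + t\<^sup>2) * r\<^sup>2 / 2))) / (1 + t\<^sup>2))" for t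
  proof -
    define c where "c = 1 + t\<^sup>2"
    have c: "0 < c" unfolding c_def by (simp add: add_pos_nonneg)
    have "has_bochner_integral lborel (\<lambda>z. (z * exp (- (c * z\<^sup>2 / 2))) * indicator {0..r} z) (- exp (- (c * r\<^sup>2 / 2)) / c - - exp (- (c * 0\<^sup>2 / 2)) / c)"
      using c assms by (intro has_bochner_integral_FTC_Icc_nonneg)
         (auto intro!: derivative_eq_intros)
    then have "has_bochner_integral lborel (\<lambda>z. (z * exp (- (c * z\<^sup>2 / 2))) * indicator {0..r} z) ((1 - exp (- (c * r\<^sup>2 / 2))) / c)"
      by (simp add: diff_divide_distrib)
    moreover have "AE z in lborel. (z * exp (- (c * z\<^sup>2 / 2))) * indicator {0..r} z = g t z"
      using AE_lborel_singleton[of 0] AE_lborel_singleton[of r]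
      by eventually_elim (auto simp: g_def c_def indicator_def)
    ultimately show ?thesis unfolding c_def[symmetric]
      by (subst (asm) has_bochner_integral_cong_AE[where g="g t"]) (auto simp: g_def[abs_def])
  qed
  have g0: "0 \<le> g t z" for t z by (simp add: g_def indicator_def)
  have meas: "case_prod g \<in> borel_measurable (lborel \<Otimes>\<^sub>M lborel)"
    unfolding g_def[abs_def] by measurable
  have int1: "integrable lborel (\<lambda>t. 1 / (1 + t\<^sup>2) :: real)"
    using has_bochner_integral_inverse_1_plus_square by (simp add: has_bochner_integral_iff)
  have int2: "integrable lborel (\<lambda>t. exp (- ((1 + t\<^sup>2) * r\<^sup>2 / 2)) / (1 + t\<^sup>2))"
    by (rule Bochner_Integration.integrable_bound[OF int1])
       (auto intro!: AE_I2 divide_right_mono simp: abs_divide)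
  have intg: "integrable (lborel \<Otimes>\<^sub>M lborel) (case_prod g)"
  proof (rule lborel_pair.Fubini_integrable[OF meas])
    have "(\<integral>z. norm (case (t, z) of (t, z) \<Rightarrow> g t z) \<partial>lborel) = 1 / (1 + t\<^sup>2) - exp (- ((1 + t\<^sup>2) * r\<^sup>2 / 2)) / (1 + t\<^sup>2)" for t
      using has_bochner_integral_integral_eq[OF g[of t]] g0 by (simp add: diff_divide_distrib)
    then show "integrable lborel (\<lambda>t. \<integral>z. norm (case (t, z) of (t, z) \<Rightarrow> g t z) \<partial>lborel)"
      using int1 int2 by simp
    show "AE t in lborel. integrable lborel (\<lambda>z. case (t, z) of (t, z) \<Rightarrow> g t z)"
      using g by (auto simp: has_bochner_integral_iff intro!: AE_I2)
  qed
  have fub: "(\<integral>z. (\<integral>t. g t z \<partial>lborel) \<partial>lborel) = (\<integral>t. (\<integral>z. g t z \<partial>lborel) \<partial>lborel)"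
    by (rule lborel_pair.Fubini_integral[OF intg])
  have "(\<integral>t. g t z \<partial>lborel) = sqrt (2 * pi) * (indicator {0<..<r} z * exp (- z\<^sup>2 / 2))" for z
  proof (cases "0 < z \<and> z < r")
    case True
    have "(\<integral>t. g t z \<partial>lborel) = (\<integral>t. (z * exp (- z\<^sup>2 / 2)) * (cos (t * 0) * exp (- (z * t)\<^sup>2 / 2)) \<partial>lborel)"
      using True by (intro Bochner_Integration.integral_cong refl)
        (simp add: g_def mult_exp_exp power_mult_distrib, simp add: algebra_simps add_divide_distrib)
    also have "\<dots> = (z * exp (- z\<^sup>2 / 2)) * (sqrt (2 * pi) / z * exp (- (0 / z)\<^sup>2 / 2))"
      using has_bochner_integral_integral_eq[OF has_bochner_integral_scaled_gaussian_cos[of z 0]] True by simp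
    finally show ?thesis using True by simp
  qed (auto simp: g_def)
  then have "(\<integral>z. (\<integral>t. g t z \<partial>lborel) \<partial>lborel) = sqrt (2 * pi) * (\<integral>z. indicator {0<..<r} z * exp (- z\<^sup>2 / 2) \<partial>lborel)"
    by simp
  also have "(\<integral>z. indicator {0<..<r} z * exp (- z\<^sup>2 / 2) \<partial>lborel) = gauss_int r"
    using assms by (simp add: gauss_int_def interval_lebesgue_integral_def set_lebesgue_integral_def einterval_eq zero_ereal_def)
  finally have "sqrt (2 * pi) * gauss_int r = (\<integral>t. 1 / (1 + t\<^sup>2) - exp (- ((1 + t\<^sup>2) * r\<^sup>2 / 2)) / (1 + t\<^sup>2) \<partial>lborel)"
    using fub has_bochner_integral_integral_eq[OF g] by (simp add: diff_divide_distrib)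
  also have "\<dots> = pi - (\<integral>t. exp (- ((1 + t\<^sup>2) * r\<^sup>2 / 2)) / (1 + t\<^sup>2) \<partial>lborel)"
    using int1 int2 has_bochner_integral_integral_eq[OF has_bochner_integral_inverse_1_plus_square] by simp
  finally show ?thesis using int2 by (simp add: has_bochner_integral_iff)
qed

section \<open>The overlap of two translates of the density\<close>

definition cpow :: "real \<Rightarrow> complex \<Rightarrow> complex" where
  "cpow t z = z * exp (\<i> * of_real t * Ln z)"

lemma cpow_holomorphic [holomorphic_intros]:
  assumes "f holomorphic_on S" "\<And>w. w \<in> S \<Longrightarrow> 0 < Re (f w)"
  shows "(\<lambda>w. cpow t (f w)) holomorphic_on S"
  unfolding cpow_def using assms
  by (intro holomorphic_intros) (auto simp: complex_nonpos_Reals_iff, force)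

text \<open>\<open>cpow t\<close> is the principal branch of the power 1 + it. On the unit circle 1
  - w has nonnegative real part and reaches 0 at w = 1, so continuity has to include the branch
  point. There the factor z wins, the exponential being bounded by exp (pi \<bar>t\<bar>).\<close>

lemma cpow_continuous: "continuous_on {z. 0 \<le> Re z} (cpow t)"
proof (rule continuous_at_imp_continuous_on, rule ballI)
  fix z :: complex assume z: "z \<in> {z. 0 \<le> Re z}"
  show "isCont (cpow t) z"
  proof (cases "z = 0")
    case False
    then show ?thesis
      unfolding cpow_def[abs_def] using z
      by (intro continuous_intros) (auto simp: complex_nonpos_Reals_iff complex_eq_iff)
  next
    case True
    have "(cpow t \<longlongrightarrow> 0) (at 0)"
    proof (rule Lim_null_comparison)
      show "\<forall>\<^sub>F w in at 0. norm (cpow t w) \<le> norm w * exp (\<bar>t\<bar> * pi)"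
      proof (intro always_eventually allI)
        fix w :: complex
        show "norm (cpow t w) \<le> norm w * exp (\<bar>t\<bar> * pi)"
        proof (cases "w = 0")
          case False
          have "- (t * Im (Ln w)) \<le> \<bar>t\<bar> * \<bar>Im (Ln w)\<bar>"
            by (metis abs_ge_minus_self abs_mult)
          also have "\<dots> \<le> \<bar>t\<bar> * pi"
            using mpi_less_Im_Ln[OF False] Im_Ln_le_pi[OF False] by (intro mult_left_mono) auto
          finally show ?thesis by (simp add: cpow_def norm_mult mult_left_mono)
        qed (simp add: cpow_def)
      qed
      show "((\<lambda>w. norm w * exp (\<bar>t\<bar> * pi)) \<longlongrightarrow> 0) (at (0::complex))"
        by (auto intro!: tendsto_eq_intros)
    qed
    moreover have "cpow t 0 = 0" by (simp add: cpow_def)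
    ultimately show ?thesis using True by (simp only: isCont_def)
  qed
qed

lemma one_minus_cis: "1 - cis (2 * x) = of_real (2 * sin x) * cis (x - pi / 2)"
proof -
  have "1 - cis (2 * x) = of_real (2 * sin x) * (- \<i> * cis x)"
    by (simp add: complex_eq_iff cos_double_sin sin_double power2_eq_square)
  also have "- \<i> * cis x = cis (x - pi / 2)"
    by (simp add: complex_eq_iff cos_diff sin_diff)
  finally show ?thesis .
qed

text \<open>The argument x - pi/2 stays between -pi/2 and pi/2, so the principal logarithm is
  explicit. Its imaginary part becomes the real factor exp (-t (x - pi/2)); two such factors later
  multiply to a constant on each arc.\<close>

lemma cpow_one_minus_cis:
  assumes "0 < x" "x < pi"
  shows "cpow t (1 - cis (2 * x)) =
    of_real (2 * sin x * exp (- t * (x - pi / 2))) * cis (x - pi / 2 + t * ln (2 * sin x))"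
proof -
  have s: "0 < sin x" using assms by (intro sin_gt_zero)
  have "Ln (1 - cis (2 * x)) = of_real (ln (2 * sin x)) + \<i> * of_real (x - pi / 2)"
  proof -
    have "1 - cis (2 * x) = exp (of_real (ln (2 * sin x)) + \<i> * of_real (x - pi / 2))"
    proof -
      have "exp (of_real (ln (2 * sin x))) = complex_of_real (2 * sin x)"
        unfolding exp_of_real using s by simp
      then have "exp (of_real (ln (2 * sin x)) + \<i> * of_real (x - pi / 2)) = of_real (2 * sin x) * cis (x - pi / 2)"
        by (simp only: exp_add cis_conv_exp)
      then show ?thesis by (simp only: one_minus_cis)
    qed
    then show ?thesis using assms by (simp only:) (intro Ln_exp; simp)
  qed
  then have "exp (\<i> * of_real t * Ln (1 - cis (2 * x))) = of_real (exp (- t * (x - pi / 2))) * cis (t * ln (2 * sin x))"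
    by (simp only:) (simp add: cis_conv_exp exp_of_real[symmetric] exp_add[symmetric] algebra_simps)
  then show ?thesis
    unfolding cpow_def by (simp only: one_minus_cis) (simp add: cis_mult[symmetric])
qed

text \<open>Cauchy's formula for the derivative at 0 of \<open>(1 - w)\<^sup>1\<^sup>+\<^sup>i\<^sup>t (1 - c w)\<^sup>1\<^sup>-\<^sup>i\<^sup>t\<close>, which extends continuously to
  the unit circle.\<close>

lemma circle_average:
  assumes "norm c = 1"
  shows "((\<lambda>s. cpow t (1 - cis (2 * pi * s)) * cpow (- t) (1 - c * cis (2 * pi * s)) * cis (- 2 * pi * s))
     has_integral (- (1 + \<i> * t) - c * (1 - \<i> * t))) {0..1}"
proof -
  define A where "A w = cpow t (1 - w) * cpow (- t) (1 - c * w)" for w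
  have re: "Re (1 - w) > 0" if "norm w < 1" for w
    using that abs_Re_le_cmod[of w] by simp
  have re': "Re (1 - w) \<ge> 0" if "norm w \<le> 1" for w
    using that abs_Re_le_cmod[of w] by simp
  have hol: "A holomorphic_on ball 0 1"
    unfolding A_def
  proof (intro holomorphic_intros)
    show "0 < Re (1 - w)" if "w \<in> ball 0 1" for w using that by (intro re) simp
    show "0 < Re (1 - c * w)" if "w \<in> ball 0 1" for w using that assms by (intro re) (simp add: norm_mult)
  qed
  have cont: "continuous_on (cball 0 1) A"
  proof -
    have "continuous_on (cball 0 1) (\<lambda>w. cpow t (1 - w))"
      by (rule continuous_on_compose2[OF cpow_continuous]) (use re' in \<open>auto intro!: continuous_intros\<close>)
    moreover have "continuous_on (cball 0 1) (\<lambda>w. cpow (- t) (1 - c * w))"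
    proof (rule continuous_on_compose2[OF cpow_continuous])
      show "(\<lambda>w. 1 - c * w) ` cball 0 1 \<subseteq> {z. 0 \<le> Re z}"
      proof (clarify)
        fix w :: complex assume "w \<in> cball 0 1"
        then show "0 \<le> Re (1 - c * w)" using assms by (intro re') (simp add: norm_mult)
      qed
    qed (intro continuous_intros)
    ultimately show ?thesis unfolding A_def[abs_def] by (rule continuous_on_mult)
  qed
  have d: "(cpow t' has_field_derivative (1 + \<i> * of_real t')) (at 1)" for t'
    unfolding cpow_def[abs_def] by (auto intro!: derivative_eq_intros simp: complex_nonpos_Reals_iff)
  have d1: "((\<lambda>w. cpow t (1 - w)) has_field_derivative (1 + \<i> * t) * (- 1)) (at 0)"
    by (rule DERIV_chain2) (use d[of t] in \<open>auto intro!: derivative_eq_intros\<close>)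
  have d2: "((\<lambda>w. cpow (- t) (1 - c * w)) has_field_derivative (1 + \<i> * (- t)) * (- c)) (at 0)"
    by (rule DERIV_chain2) (use d[of "- t"] in \<open>auto intro!: derivative_eq_intros\<close>)
  have "(A has_field_derivative (1 + \<i> * t) * (- 1) * cpow (- t) (1 - c * 0) + (1 + \<i> * (- t)) * (- c) * cpow t (1 - 0)) (at 0)"
    unfolding A_def[abs_def] by (rule DERIV_mult'[OF d1 d2, THEN DERIV_cong]) simp
  then have dA: "(A has_field_derivative (- (1 + \<i> * t) - c * (1 - \<i> * t))) (at 0)"
    by (rule DERIV_cong) (simp add: cpow_def algebra_simps)
  note C = Cauchy_derivative_integral_circlepath[OF cont hol, of 0]
  have "(- (1 + \<i> * t) - c * (1 - \<i> * t)) = 1 / (2 * of_real pi * \<i>) * contour_integral (circlepath 0 1) (\<lambda>u. A u / (u - 0)\<^sup>2)"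
    using DERIV_unique[OF dA] C(2) by simp
  moreover have "((\<lambda>u. A u / (u - 0)\<^sup>2) has_contour_integral contour_integral (circlepath 0 1) (\<lambda>u. A u / (u - 0)\<^sup>2)) (circlepath 0 1)"
    using C(1) by (intro has_contour_integral_integral) auto
  ultimately have "((\<lambda>u. 1 / (2 * of_real pi * \<i>) * (A u / (u - 0)\<^sup>2)) has_contour_integral (- (1 + \<i> * t) - c * (1 - \<i> * t))) (circlepath 0 1)"
    by (simp only: has_contour_integral_lmul)
  then have "((\<lambda>s. 1 / (2 * of_real pi * \<i>) * (A (circlepath 0 1 s) / (circlepath 0 1 s - 0)\<^sup>2) * vector_derivative (circlepath 0 1) (at s within {0..1}))
     has_integral (- (1 + \<i> * t) - c * (1 - \<i> * t))) {0..1}"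
    unfolding has_contour_integral_def .
  then show ?thesis
  proof (rule has_integral_eq[rotated])
    fix s :: real assume s: "s \<in> {0..1}"
    have e: "exp (2 * of_real pi * \<i> * of_real s) = cis (2 * pi * s)"
      by (simp add: cis_conv_exp mult_ac)
    have e': "cis (2 * pi * s) * cis (- 2 * pi * s) = 1"
      by (simp add: cis_mult)
    define z where "z = cis (2 * pi * s)"
    have z: "z \<noteq> 0" "cis (- 2 * pi * s) = 1 / z"
      using e' by (auto simp: z_def field_simps)
    \<comment> \<open>The kernel contributes 1/z^2 and the path derivative 2 pi i z, which leaves a
      single factor 1/z.\<close>
    have "1 / (2 * of_real pi * \<i>) * (A z / (z - 0)\<^sup>2) * (2 * of_real pi * \<i> * z) = A z * (1 / z)"
      using z(1) by (simp add: power2_eq_square)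
    moreover have "circlepath 0 1 s = z"
      unfolding circlepath e z_def by simp
    moreover have "vector_derivative (circlepath 0 1) (at s within {0..1}) = 2 * of_real pi * \<i> * z"
      using s by (simp only: vector_derivative_circlepath01 e z_def of_real_1 of_real_mult of_real_numeral mult_1_right atLeastAtMost_iff)
    ultimately show "1 / (2 * of_real pi * \<i>) * (A (circlepath 0 1 s) / (circlepath 0 1 s - 0)\<^sup>2) * vector_derivative (circlepath 0 1) (at s within {0..1}) =
      cpow t (1 - cis (2 * pi * s)) * cpow (- t) (1 - c * cis (2 * pi * s)) * cis (- 2 * pi * s)"
      by (simp only: z(2)) (simp only: z_def A_def)
  qed
qed


lemma borel_measurable_cis [measurable]: "cis \<in> borel_measurable borel"
  by (intro borel_measurable_continuous_onI continuous_intros)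

text \<open>The integral of exp (i t Y) for a shift by \<beta>/pi, where Y is half the
  log-likelihood ratio and the weight is the geometric mean of the two densities. A Gaussian shift
  with the same Fisher information gives exp (-(1 + t^2) \<beta>^2 / 2). At t = 0 the quotient is 0
  by convention, so the integral formula is stated for nonzero t.\<close>

definition chi :: "real \<Rightarrow> real \<Rightarrow> real" where
  "chi \<beta> t = (cos \<beta> * sinh ((pi - \<beta>) * t) + t * sin \<beta> * cosh ((pi - \<beta>) * t)) / sinh (pi * t)"

text \<open>For \<open>c = exp (2 i \<beta>)\<close> the circle splits into two arcs, on which the branches of the logarithm differ by a constant.\<close>

lemma arc_integrals:
  fixes \<beta> t :: real
  assumes \<beta>: "0 \<le> \<beta>" "\<beta> < pi"
  defines "W1 \<equiv> \<lambda>t s. indicator {0<..<1 - \<beta> / pi} s *\<^sub>R (of_real (4 * sin (pi * s) * sin (pi * s + \<beta>)) * cis (t * (ln (sin (pi * s)) - ln (sin (pi * s + \<beta>)))))"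
  defines "W2 \<equiv> \<lambda>t s. indicator {1 - \<beta> / pi<..<1} s *\<^sub>R (of_real (- 4 * sin (pi * s) * sin (pi * s + \<beta> - pi)) * cis (t * (ln (sin (pi * s)) - ln (sin (pi * s + \<beta> - pi)))))"
  shows "integrable lborel (W1 t)" "integrable lborel (W2 t)"
    "of_real (exp (t * \<beta>)) * (\<integral>s. W1 t s \<partial>lborel) + of_real (exp (- (t * (pi - \<beta>)))) * (\<integral>s. W2 t s \<partial>lborel)
       = of_real (2 * cos \<beta> + 2 * t * sin \<beta>)"
proof -
  define \<delta> where "\<delta> = \<beta> / pi"
  have \<delta>: "0 \<le> \<delta>" "\<delta> < 1" "\<beta> = pi * \<delta>" using \<beta> by (auto simp: \<delta>_def)
  have bnd: "norm (of_real (k * sin a * sin b) * cis c) \<le> 4" if "\<bar>k\<bar> = 4" for k a b c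
    using that by (simp add: norm_mult abs_mult mult_le_one)
  show int1: "integrable lborel (W1 t)" for t
  proof (rule Bochner_Integration.integrable_bound)
    show "integrable lborel (\<lambda>s::real. 4 * indicator {0..1} s :: real)"
      by (intro integrable_mult_right integrable_real_indicator) auto
    show "W1 t \<in> borel_measurable lborel" unfolding W1_def by measurable
    show "AE s in lborel. norm (W1 t s) \<le> norm (4 * indicator {0..1} s :: real)"
      using bnd[of 4] \<delta> by (intro AE_I2) (auto simp: W1_def \<delta>_def[symmetric] indicator_def)
  qed
  show int2: "integrable lborel (W2 t)" for t
  proof (rule Bochner_Integration.integrable_bound)
    show "integrable lborel (\<lambda>s::real. 4 * indicator {0..1} s :: real)"
      by (intro integrable_mult_right integrable_real_indicator) auto
    show "W2 t \<in> borel_measurable lborel" unfolding W2_def by measurable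
    show "AE s in lborel. norm (W2 t s) \<le> norm (4 * indicator {0..1} s :: real)"
      using bnd[of "-4"] \<delta> by (intro AE_I2) (auto simp: W2_def \<delta>_def[symmetric] indicator_def)
  qed
  define f where "f s = cpow t (1 - cis (2 * pi * s)) * cpow (- t) (1 - cis (2 * \<beta>) * cis (2 * pi * s)) * cis (- 2 * pi * s)" for s
  define g where "g s = - cis \<beta> * (of_real (exp (t * \<beta>)) * W1 t s + of_real (exp (- (t * (pi - \<beta>)))) * W2 t s)" for s
  have eq: "indicator {0..1} s *\<^sub>R f s = g s" if s: "s \<notin> {0, 1, 1 - \<delta>}" for s
  proof -
    consider "s \<notin> {0..1}" | "0 < s" "s < 1 - \<delta>" | "1 - \<delta> < s" "s < 1"
      using s \<delta> by force
    then show ?thesis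
    proof cases
      case 1
      then show ?thesis using \<delta> by (auto simp: g_def W1_def W2_def \<delta>_def[symmetric] indicator_def)
    next
      case 2
      define x y where "x = pi * s" and "y = pi * s + \<beta>"
      have "pi * s < pi * (1 - \<delta>)" using 2 by simp
      then have x: "0 < x" "x < pi" and y: "0 < y" "y < pi"
        using 2 \<delta> by (auto simp: x_def y_def algebra_simps intro!: add_nonneg_pos)
      have sp: "0 < sin x" "0 < sin y" using x y by (auto intro: sin_gt_zero)
      have "f s = cpow t (1 - cis (2 * x)) * cpow (- t) (1 - cis (2 * y)) * cis (- 2 * x)"
        by (simp add: f_def x_def y_def cis_mult algebra_simps)
      also have "\<dots> = of_real (4 * sin x * sin y * (exp (- t * (x - pi / 2)) * exp (t * (y - pi / 2)))) *
          (cis (x - pi / 2 + t * ln (2 * sin x)) * cis (y - pi / 2 + (- t) * ln (2 * sin y)) * cis (- 2 * x))"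
        unfolding cpow_one_minus_cis[OF x] cpow_one_minus_cis[OF y] by simp
      also have "exp (- t * (x - pi / 2)) * exp (t * (y - pi / 2)) = exp (t * \<beta>)"
        by (simp add: exp_add[symmetric] x_def y_def algebra_simps)
      also have "cis (x - pi / 2 + t * ln (2 * sin x)) * cis (y - pi / 2 + (- t) * ln (2 * sin y)) * cis (- 2 * x)
         = cis (\<beta> - pi) * cis (t * (ln (sin x) - ln (sin y)))"
        using sp by (simp add: cis_mult ln_mult x_def y_def algebra_simps)
      also have "cis (\<beta> - pi) = - cis \<beta>"
        by (simp add: complex_eq_iff)
      finally show ?thesis
        using 2 \<delta> by (simp add: g_def W1_def W2_def \<delta>_def[symmetric] x_def y_def)
    next
      case 3
      \<comment> \<open>Here the angle pi s + \<beta> has passed pi and is reduced to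
        \<open>y\<close> between 0 and pi; compared with the first arc, the constant exp (t \<beta>)
        turns into exp (-t (pi - \<beta>)).\<close>
      define x y where "x = pi * s" and "y = pi * s + \<beta> - pi"
      have "pi * (1 - \<delta>) < pi * s" "pi * s < pi" "\<beta> < pi" using 3 \<delta> \<beta> by simp_all
      moreover have "pi - \<beta> < pi * s"
        using \<open>pi * (1 - \<delta>) < pi * s\<close> by (simp add: \<delta>(3) right_diff_distrib)
      ultimately have x: "0 < x" "x < pi" and y: "0 < y" "y < pi"
        using \<beta> unfolding x_def y_def by linarith+
      have sp: "0 < sin x" "0 < sin y" using x y by (auto intro: sin_gt_zero)
      have "cis (2 * \<beta>) * cis (2 * pi * s) = cis (2 * y)"
        by (simp add: y_def cis_mult complex_eq_iff algebra_simps cos_diff sin_diff cos_add sin_add)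
      then have "f s = cpow t (1 - cis (2 * x)) * cpow (- t) (1 - cis (2 * y)) * cis (- 2 * x)"
        by (simp add: f_def x_def mult.assoc)
      also have "\<dots> = of_real (4 * sin x * sin y * (exp (- t * (x - pi / 2)) * exp (t * (y - pi / 2)))) *
          (cis (x - pi / 2 + t * ln (2 * sin x)) * cis (y - pi / 2 + (- t) * ln (2 * sin y)) * cis (- 2 * x))"
        unfolding cpow_one_minus_cis[OF x] cpow_one_minus_cis[OF y] by simp
      also have "exp (- t * (x - pi / 2)) * exp (t * (y - pi / 2)) = exp (- (t * (pi - \<beta>)))"
        by (simp add: exp_add[symmetric] x_def y_def algebra_simps)
      also have "cis (x - pi / 2 + t * ln (2 * sin x)) * cis (y - pi / 2 + (- t) * ln (2 * sin y)) * cis (- 2 * x)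
         = cis (\<beta> - 2 * pi) * cis (t * (ln (sin x) - ln (sin y)))"
      proof -
        have l: "ln (2 * sin x) = ln 2 + ln (sin x)" "ln (2 * sin y) = ln 2 + ln (sin y)"
          using sp by (simp_all add: ln_mult)
        show ?thesis unfolding cis_mult l
          by (intro arg_cong[where f=cis]) (simp add: x_def y_def algebra_simps)
      qed
      also have "cis (\<beta> - 2 * pi) = cis \<beta>"
        by (simp add: complex_eq_iff cos_diff sin_diff)
      finally show ?thesis
        using 3 \<delta> by (simp add: g_def W1_def W2_def \<delta>_def[symmetric] x_def y_def)
    qed
  qed
  have intg: "integrable lborel g"
    unfolding g_def using int1 int2 by (intro integrable_mult_right Bochner_Integration.integrable_add)
  have "(f has_integral (- (1 + \<i> * t) - cis (2 * \<beta>) * (1 - \<i> * t))) {0..1}"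
    unfolding f_def by (rule circle_average) simp
  then have "((\<lambda>s. indicator {0..1} s *\<^sub>R f s) has_integral (- (1 + \<i> * t) - cis (2 * \<beta>) * (1 - \<i> * t))) UNIV"
  proof -
    have "(\<lambda>s. indicator {0..1} s *\<^sub>R f s) = (\<lambda>s. if s \<in> {0..1} then f s else 0)"
      by (auto simp: indicator_def fun_eq_iff)
    then show ?thesis
      using \<open>(f has_integral _) _\<close> by (simp only: has_integral_restrict_UNIV)
  qed
  then have "(g has_integral (- (1 + \<i> * t) - cis (2 * \<beta>) * (1 - \<i> * t))) UNIV"
    by (rule has_integral_spike_finite[rotated 2, where S="{0, 1, 1 - \<delta>}"]) (use eq in auto)
  then have "integral\<^sup>L lborel g = - (1 + \<i> * t) - cis (2 * \<beta>) * (1 - \<i> * t)"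
    using has_integral_integral_lborel[OF intg] has_integral_unique by blast
  moreover have "integral\<^sup>L lborel g = - cis \<beta> * (of_real (exp (t * \<beta>)) * (\<integral>s. W1 t s \<partial>lborel) + of_real (exp (- (t * (pi - \<beta>)))) * (\<integral>s. W2 t s \<partial>lborel))"
    unfolding g_def using int1 int2 by simp
  \<comment> \<open>Pulling out the phase -cis \<beta> leaves a real right-hand side, which makes
    conjugation fruitful below.\<close>
  moreover have "- (1 + \<i> * t) - cis (2 * \<beta>) * (1 - \<i> * t) = - cis \<beta> * of_real (2 * cos \<beta> + 2 * t * sin \<beta>)"
  proof -
    have "cis \<beta> * cis (- \<beta>) = 1" by (simp add: cis_mult)
    moreover have "of_real (2 * cos \<beta> + 2 * t * sin \<beta>) = (1 + \<i> * t) * cis (- \<beta>) + (1 - \<i> * t) * cis \<beta>"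
      by (simp add: complex_eq_iff)
    moreover have "cis (2 * \<beta>) = cis \<beta> * cis \<beta>" by (simp add: cis_mult)
    ultimately show ?thesis by (simp only:) (simp add: algebra_simps)
  qed
  ultimately have "- cis \<beta> * (of_real (exp (t * \<beta>)) * (\<integral>s. W1 t s \<partial>lborel) + of_real (exp (- (t * (pi - \<beta>)))) * (\<integral>s. W2 t s \<partial>lborel))
     = - cis \<beta> * of_real (2 * cos \<beta> + 2 * t * sin \<beta>)" by metis
  then show "of_real (exp (t * \<beta>)) * (\<integral>s. W1 t s \<partial>lborel) + of_real (exp (- (t * (pi - \<beta>)))) * (\<integral>s. W2 t s \<partial>lborel)
       = of_real (2 * cos \<beta> + 2 * t * sin \<beta>)"
    by (subst (asm) mult_cancel_left) simp
qed


text \<open>The relations for t and -t determine the integral over the first arc.\<close>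

lemma integral_eq_chi:
  fixes \<beta> t :: real
  assumes \<beta>: "0 \<le> \<beta>" "\<beta> < pi" and "t \<noteq> 0"
  shows "(\<integral>s. indicator {0<..<1 - \<beta> / pi} s *\<^sub>R (of_real (2 * sin (pi * s) * sin (pi * s + \<beta>)) * cis (t * (ln (sin (pi * s)) - ln (sin (pi * s + \<beta>))))) \<partial>lborel)
    = of_real (chi \<beta> t)"
proof -
  define W1 where "W1 t s = indicator {0<..<1 - \<beta> / pi} s *\<^sub>R (of_real (4 * sin (pi * s) * sin (pi * s + \<beta>)) * cis (t * (ln (sin (pi * s)) - ln (sin (pi * s + \<beta>)))))" for t s
  define W2 where "W2 t s = indicator {1 - \<beta> / pi<..<1} s *\<^sub>R (of_real (- 4 * sin (pi * s) * sin (pi * s + \<beta> - pi)) * cis (t * (ln (sin (pi * s)) - ln (sin (pi * s + \<beta> - pi)))))" for t s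
  note arc = arc_integrals[OF \<beta>, folded W1_def W2_def]
  define X where "X t = (\<integral>s. W1 t s \<partial>lborel)" for t
  define Z where "Z t = (\<integral>s. W2 t s \<partial>lborel)" for t
  have cnj1: "W1 (- t) s = cnj (W1 t s)" and cnj2: "W2 (- t) s = cnj (W2 t s)" for s
    by (simp_all add: W1_def W2_def cis_cnj)
  \<comment> \<open>Changing the sign of t conjugates both arc integrals, so the conjugated relation
    for -t is a second linear equation in the same two unknowns.\<close>
  have cnjX: "X (- t) = cnj (X t)" and cnjZ: "Z (- t) = cnj (Z t)"
    unfolding X_def Z_def cnj1 cnj2 by simp_all
  have E1: "of_real (exp (t * \<beta>)) * X t + of_real (exp (- (t * (pi - \<beta>)))) * Z t = of_real (2 * cos \<beta> + 2 * t * sin \<beta>)"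
    using arc(3)[of t] by (simp only: X_def Z_def)
  have "of_real (exp (- t * \<beta>)) * X (- t) + of_real (exp (- (- t * (pi - \<beta>)))) * Z (- t) = of_real (2 * cos \<beta> + 2 * (- t) * sin \<beta>)"
    using arc(3)[of "- t"] by (simp only: X_def Z_def)
  then have "cnj (of_real (exp (- t * \<beta>)) * X (- t) + of_real (exp (- (- t * (pi - \<beta>)))) * Z (- t)) = cnj (of_real (2 * cos \<beta> + 2 * (- t) * sin \<beta>))"
    by simp
  then have E2: "of_real (exp (- t * \<beta>)) * X t + of_real (exp (t * (pi - \<beta>))) * Z t = of_real (2 * cos \<beta> - 2 * t * sin \<beta>)"
    by (simp only: cnjX cnjZ complex_cnj_add complex_cnj_mult complex_cnj_cnj complex_cnj_complex_of_real) simp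
  define e where "e = exp (t * (pi - \<beta>))"
  have e: "exp (- (t * (pi - \<beta>))) = 1 / e" "e \<noteq> 0" by (simp_all add: e_def exp_minus divide_inverse)
  \<comment> \<open>Elimination of \<open>Z t\<close>. The remaining coefficient is 2 sinh (pi t),
    the source of the denominator of \<open>chi\<close>.\<close>
  have "of_real (exp (t * \<beta>) * e - exp (- t * \<beta>) / e) * X t
      = of_real e * (of_real (exp (t * \<beta>)) * X t + of_real (1 / e) * Z t) - of_real (1 / e) * (of_real (exp (- t * \<beta>)) * X t + of_real e * Z t)"
    using e by (simp add: algebra_simps)
  also have "\<dots> = of_real (e * (2 * cos \<beta> + 2 * t * sin \<beta>) - (1 / e) * (2 * cos \<beta> - 2 * t * sin \<beta>))"
    using E1 E2 unfolding e(1) e_def[symmetric] by (simp only: of_real_mult of_real_diff)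
  also have "e * (2 * cos \<beta> + 2 * t * sin \<beta>) - (1 / e) * (2 * cos \<beta> - 2 * t * sin \<beta>)
      = 2 * cos \<beta> * (e - 1 / e) + 2 * t * sin \<beta> * (e + 1 / e)"
    by (simp add: algebra_simps diff_divide_distrib add_divide_distrib)
  also have "\<dots> = 4 * (cos \<beta> * sinh ((pi - \<beta>) * t) + t * sin \<beta> * cosh ((pi - \<beta>) * t))"
    unfolding e(1)[symmetric] unfolding e_def sinh_field_def cosh_field_def by (simp add: field_simps)
  also have "exp (t * \<beta>) * e - exp (- t * \<beta>) / e = 2 * sinh (pi * t)"
    unfolding e_def sinh_field_def
    by (simp add: exp_add[symmetric] exp_diff[symmetric] algebra_simps)
  finally have "of_real (2 * sinh (pi * t)) * X t = of_real (4 * (cos \<beta> * sinh ((pi - \<beta>) * t) + t * sin \<beta> * cosh ((pi - \<beta>) * t)))" .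
  moreover have "sinh (pi * t) \<noteq> 0" using \<open>t \<noteq> 0\<close> by simp
  ultimately have Xt: "X t = of_real (4 * (cos \<beta> * sinh ((pi - \<beta>) * t) + t * sin \<beta> * cosh ((pi - \<beta>) * t))) / of_real (2 * sinh (pi * t))"
    by (metis mult_eq_0_iff nonzero_mult_div_cancel_left of_real_eq_0_iff zero_neq_numeral)
  then have "X t = of_real (2 * chi \<beta> t)"
  proof -
    have "4 * D / (2 * Q) = 2 * (D / Q)" for D Q :: real by simp
    then show ?thesis using Xt by (simp only: of_real_divide[symmetric] chi_def)
  qed
  then have "of_real (1 / 2) * X t = of_real (chi \<beta> t)" by simp
  also have "of_real (1 / 2) * X t = (\<integral>s. of_real (1 / 2) * W1 t s \<partial>lborel)"
    unfolding X_def by simp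
  also have "\<dots> = (\<integral>s. indicator {0<..<1 - \<beta> / pi} s *\<^sub>R (of_real (2 * sin (pi * s) * sin (pi * s + \<beta>)) * cis (t * (ln (sin (pi * s)) - ln (sin (pi * s + \<beta>))))) \<partial>lborel)"
    by (intro Bochner_Integration.integral_cong refl) (simp add: W1_def indicator_def)
  finally show ?thesis .
qed

section \<open>Comparison with a Gaussian exponent\<close>

text \<open>\<open>h_rate\<close> is the best rate for which \<open>exp (- (1 + t\<^sup>2) h)\<close> stays below \<open>chi\<close> simultaneously for all t
  (equality of logarithmic derivatives holds as t tends to 0); the Gaussian shift has rate z.\<close>

definition h_rate :: "real \<Rightarrow> real" where
  "h_rate z = sin z * (pi - z) / ((pi - z) * cos z + sin z)"

definition h_exp :: "real \<Rightarrow> real" where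
  "h_exp b = integral {0..b} h_rate"

lemma h_rate_denominator_pos:
  assumes "0 \<le> z" "z \<le> pi / 2"
  shows "0 < (pi - z) * cos z + sin z"
proof (cases "z = 0")
  case False
  then have "0 < sin z" using assms by (intro sin_gt_zero) auto
  moreover have "0 \<le> (pi - z) * cos z" using assms by (intro mult_nonneg_nonneg cos_ge_zero) auto
  ultimately show ?thesis by simp
qed simp

lemma h_rate_continuous: "continuous_on {0..pi / 2} h_rate"
  unfolding h_rate_def using h_rate_denominator_pos by (intro continuous_intros) force

lemma h_rate_nonneg: "0 \<le> z \<Longrightarrow> z \<le> pi / 2 \<Longrightarrow> 0 \<le> h_rate z"
  using h_rate_denominator_pos[of z] unfolding h_rate_def
  by (intro divide_nonneg_pos mult_nonneg_nonneg sin_ge_zero) auto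

text \<open>After clearing the denominator the claim is 0 < g z, where g vanishes at 0 and at pi/2.
  Its derivative has the sign of 2 - z (pi - z), and z (pi - z) increases, so g increases up to z or
  else decreases from z on; either end gives positivity.\<close>

lemma h_rate_less:
  assumes "0 < z" "z < pi / 2"
  shows "h_rate z < z"
proof -
  define g where "g z = z * (pi - z) * cos z - (pi - 2 * z) * sin z" for z :: real
  have der: "DERIV g z :> sin z * (2 - z * (pi - z))" for z
    unfolding g_def by (auto intro!: derivative_eq_intros simp: algebra_simps)
  have cont: "continuous_on S g" for S
    unfolding g_def by (intro continuous_intros)
  have mono: "u * (pi - u) < w * (pi - w)" if "u < w" "w \<le> pi / 2" for u w
  proof -
    have "0 < (w - u) * (pi - (u + w))" using that by (intro mult_pos_pos) auto
    then show ?thesis by (simp add: algebra_simps)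
  qed
  have "0 < g z"
  proof (cases "z * (pi - z) \<le> 2")
    case True
    have "g 0 < g z"
    proof (rule DERIV_pos_imp_increasing_open[OF assms(1)])
      show "\<exists>d. DERIV g x :> d \<and> 0 < d" if "0 < x" "x < z" for x
        using der[of x] that mono[of x z] True assms
        by (intro exI[of _ "sin x * (2 - x * (pi - x))"] conjI mult_pos_pos sin_gt_zero) auto
    qed (rule cont)
    then show ?thesis by (simp add: g_def)
  next
    case False
    have "g (pi / 2) < g z"
    proof (rule DERIV_neg_imp_decreasing_open[OF assms(2)])
      show "\<exists>d. DERIV g x :> d \<and> d < 0" if "z < x" "x < pi / 2" for x
        using der[of x] that mono[of z x] False assms
        by (intro exI[of _ "sin x * (2 - x * (pi - x))"] conjI mult_pos_neg sin_gt_zero) auto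
    qed (rule cont)
    then show ?thesis by (simp add: g_def)
  qed
  then have "sin z * (pi - z) < z * ((pi - z) * cos z + sin z)"
    by (simp add: g_def algebra_simps)
  then show ?thesis
    using h_rate_denominator_pos[of z] assms unfolding h_rate_def by (subst pos_divide_less_eq) auto
qed

lemma h_exp_0 [simp]: "h_exp 0 = 0" by (simp add: h_exp_def)

lemma h_exp_continuous: "continuous_on {0..pi / 2} h_exp"
  unfolding h_exp_def by (intro indefinite_integral_continuous_1 integrable_continuous_real h_rate_continuous)

lemma DERIV_h_exp:
  assumes "0 < b" "b < pi / 2"
  shows "DERIV h_exp b :> h_rate b"
proof -
  have "(h_exp has_real_derivative h_rate b) (at b within {0..pi / 2})"
    unfolding h_exp_def[abs_def] using assms
    by (intro integral_has_real_derivative h_rate_continuous) auto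
  then have "(h_exp has_real_derivative h_rate b) (at b within {0<..<pi / 2})"
    by (rule DERIV_subset) auto
  then show ?thesis using assms by (subst (asm) at_within_open) auto
qed

lemma h_exp_mono:
  assumes "0 \<le> a" "a \<le> b" "b \<le> pi / 2"
  shows "h_exp a \<le> h_exp b"
proof (cases "a = b")
  case False
  have "continuous_on {a..b} h_exp" using assms by (intro continuous_on_subset[OF h_exp_continuous]) auto
  then show ?thesis
    using assms False
    by (intro DERIV_nonneg_imp_increasing_open[of a b h_exp]) (auto intro!: DERIV_h_exp exI[of _ "h_rate _"] h_rate_nonneg)
qed simp

text \<open>The rates agree at 0 and at pi/2, but strictness between them survives integration. This
  is the gap that later absorbs the discretisation error.\<close>

lemma h_exp_less:
  assumes "0 < b" "b \<le> pi / 2"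
  shows "h_exp b < b\<^sup>2 / 2"
proof -
  have "(0::real)\<^sup>2 / 2 - h_exp 0 < b\<^sup>2 / 2 - h_exp b"
  proof (rule DERIV_pos_imp_increasing_open[OF assms(1)])
    show "\<exists>d. DERIV (\<lambda>b. b\<^sup>2 / 2 - h_exp b) x :> d \<and> 0 < d" if "0 < x" "x < b" for x
      using that assms DERIV_h_exp[of x] h_rate_less[of x]
      by (intro exI[of _ "x - h_rate x"]) (auto intro!: derivative_eq_intros)
    show "continuous_on {0..b} (\<lambda>b. b\<^sup>2 / 2 - h_exp b)"
      using assms by (intro continuous_intros continuous_on_subset[OF h_exp_continuous]) auto
  qed
  then show ?thesis by simp
qed

lemma chi_minus: "chi b (- t) = chi b t"
proof -
  have "chi b (- t) = (- (cos b * sinh ((pi - b) * t) + t * sin b * cosh ((pi - b) * t))) / (- sinh (pi * t))"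
    by (simp add: chi_def)
  also have "\<dots> = chi b t" unfolding chi_def by (rule minus_divide_divide)
  finally show ?thesis .
qed

lemma sinh_le_mult_cosh:
  assumes "0 \<le> (x::real)"
  shows "sinh x \<le> x * cosh x"
proof -
  have "0 * cosh 0 - sinh 0 \<le> x * cosh x - sinh x"
  proof (rule DERIV_nonneg_imp_nondecreasing[OF assms])
    show "\<exists>d. DERIV (\<lambda>x. x * cosh x - sinh x) z :> d \<and> 0 \<le> d" if "0 \<le> z" "z \<le> x" for z :: real
      using that by (intro exI[of _ "z * sinh z"]) (auto intro!: derivative_eq_intros)
  qed
  then show ?thesis by simp
qed

text \<open>The quotient of the two sides, as a function of b, starts at 1 and does not decrease.
  The numerator of \<open>chi\<close> has derivative -(1 + t^2) sin b sinh ((pi - b) t), so 1 + t^2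
  is a common factor and the sign reduces to tanh (c t) \<le> c t with c = pi - b. Negative t follow
  by evenness.\<close>

lemma chi_ge:
  assumes b: "0 \<le> b" "b \<le> pi / 2" and "t \<noteq> 0"
  shows "exp (- ((1 + t\<^sup>2) * h_exp b)) \<le> chi b t"
proof -
  have pos: "exp (- ((1 + t\<^sup>2) * h_exp b)) \<le> chi b t" if t: "0 < t" for t
  proof -
    define \<phi> where "\<phi> b = chi b t * exp ((1 + t\<^sup>2) * h_exp b)" for b
    have cont: "continuous_on {0..b} \<phi>"
      unfolding \<phi>_def chi_def using b t
      by (intro continuous_intros continuous_on_subset[OF h_exp_continuous]) auto
    have "\<phi> 0 \<le> \<phi> b"
    proof (cases "b = 0")
      case False
      show ?thesis
      proof (rule DERIV_nonneg_imp_increasing_open[of 0 b \<phi>])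
        show "0 \<le> b" by fact
        fix x assume x: "0 < x" "x < b"
        define S where "S = sinh ((pi - x) * t)"
        define K where "K = cosh ((pi - x) * t)"
        define E where "E = exp ((1 + t\<^sup>2) * h_exp x)"
        define Q where "Q = sinh (pi * t)"
        have S: "0 < S" "0 < Q" using x b t by (auto simp: S_def Q_def)
        have dchi: "DERIV (\<lambda>b. chi b t) x :> - (1 + t\<^sup>2) * sin x * S / Q"
        proof -
          have "DERIV (\<lambda>b. cos b * sinh ((pi - b) * t) + t * sin b * cosh ((pi - b) * t)) x :> - (1 + t\<^sup>2) * sin x * S"
            unfolding S_def by (auto intro!: derivative_eq_intros simp: power2_eq_square algebra_simps)
          then show ?thesis unfolding chi_def Q_def by (rule DERIV_cdivide)
        qed
        have dE: "DERIV (\<lambda>b. exp ((1 + t\<^sup>2) * h_exp b)) x :> E * ((1 + t\<^sup>2) * h_rate x)"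
          unfolding E_def using x b by (auto intro!: derivative_eq_intros DERIV_h_exp)
        have "DERIV \<phi> x :> chi x t * (E * ((1 + t\<^sup>2) * h_rate x)) + (- (1 + t\<^sup>2) * sin x * S / Q) * E"
          using DERIV_mult'[OF dchi dE] by (simp add: \<phi>_def[abs_def] E_def)
        moreover have "0 \<le> chi x t * (E * ((1 + t\<^sup>2) * h_rate x)) + (- (1 + t\<^sup>2) * sin x * S / Q) * E"
        proof -
          define c where "c = pi - x"
          have c: "0 < c" "0 < c * cos x + sin x"
            using x b h_rate_denominator_pos[of x] by (auto simp: c_def)
          have "S \<le> (c * t) * K"
            unfolding S_def K_def c_def using x b t by (intro sinh_le_mult_cosh mult_nonneg_nonneg) auto
          then have "S / c \<le> t * K" using c by (simp add: field_simps)
          then have "sin x * (S / c) \<le> sin x * (t * K)"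
            using x b by (intro mult_left_mono sin_ge_zero) auto
          then have "h_rate x * (cos x * S + sin x * (S / c)) \<le> h_rate x * (cos x * S + t * sin x * K)"
            using x b by (intro mult_left_mono h_rate_nonneg) (auto simp: mult_ac)
          \<comment> \<open>The denominator of \<open>h_rate\<close> is chosen to make this an
            identity.\<close>
          also have "h_rate x * (cos x * S + sin x * (S / c)) = sin x * S"
          proof -
            have "cos x * S + sin x * (S / c) = S * (c * cos x + sin x) / c"
              using c by (simp add: field_simps)
            then show ?thesis using c by (simp add: h_rate_def c_def[symmetric])
          qed
          finally have "0 \<le> h_rate x * (cos x * S + t * sin x * K) - sin x * S" by simp
          then have "0 \<le> (1 + t\<^sup>2) * E / Q * (h_rate x * (cos x * S + t * sin x * K) - sin x * S)"
            using S by (intro mult_nonneg_nonneg divide_nonneg_pos) (auto simp: E_def)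
          also have "\<dots> = chi x t * (E * ((1 + t\<^sup>2) * h_rate x)) + (- (1 + t\<^sup>2) * sin x * S / Q) * E"
            unfolding chi_def S_def[symmetric] K_def[symmetric] Q_def[symmetric]
            by (simp add: algebra_simps diff_divide_distrib add_divide_distrib)
          finally show ?thesis .
        qed
        ultimately show "\<exists>d. DERIV \<phi> x :> d \<and> 0 \<le> d" by blast
      qed (rule cont)
    qed simp
    moreover have "\<phi> 0 = 1" using t by (simp add: \<phi>_def chi_def)
    ultimately have "1 \<le> chi b t * exp ((1 + t\<^sup>2) * h_exp b)" by (simp add: \<phi>_def)
    then show ?thesis by (simp add: exp_minus inverse_eq_divide pos_divide_le_eq)
  qed
  show ?thesis
  proof (cases "0 < t")
    case False
    then have "0 < - t" using \<open>t \<noteq> 0\<close> by simp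
    from pos[OF this] show ?thesis by (simp add: chi_minus)
  qed (rule pos)
qed

section \<open>From one coordinate to the product density\<close>

lemma lborel_product_integral:
  fixes f :: "'a::euclidean_space \<Rightarrow> real \<Rightarrow> 'c::{real_normed_field,banach,second_countable_topology}"
  assumes f: "\<And>b. b \<in> Basis \<Longrightarrow> integrable lborel (f b)"
  shows "integrable lborel (\<lambda>x::'a. \<Prod>b\<in>Basis. f b (x \<bullet> b))"
    and "(\<integral>x. (\<Prod>b\<in>Basis. f b (x \<bullet> b)) \<partial>(lborel :: 'a measure)) = (\<Prod>b\<in>Basis. integral\<^sup>L lborel (f b))"
proof -
  interpret product_sigma_finite "\<lambda>_::'a. lborel :: real measure" ..
  have [measurable]: "f b \<in> borel_measurable borel" if "b \<in> Basis" for b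
    using borel_measurable_integrable[OF f[OF that]] by simp
  have m: "(\<lambda>x::'a. \<Prod>b\<in>Basis. f b (x \<bullet> b)) \<in> borel_measurable borel"
    by measurable
  have s: "(\<lambda>g. \<Sum>b\<in>Basis. g b *\<^sub>R b) \<in> measurable (\<Pi>\<^sub>M b\<in>Basis. lborel) (borel :: 'a measure)"
    by measurable
  have e: "(\<Prod>b\<in>Basis. f b ((\<Sum>c\<in>Basis. g c *\<^sub>R c) \<bullet> b)) = (\<Prod>b\<in>Basis. f b (g b))" for g :: "'a \<Rightarrow> real"
    by (intro prod.cong refl) (simp add: inner_sum_left inner_Basis if_distrib cong: if_cong)
  show "integrable lborel (\<lambda>x::'a. \<Prod>b\<in>Basis. f b (x \<bullet> b))"
    unfolding lborel_eq[where 'a='a] integrable_distr_eq[OF s m] e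
    by (intro product_integrable_prod f) auto
  show "(\<integral>x. (\<Prod>b\<in>Basis. f b (x \<bullet> b)) \<partial>(lborel :: 'a measure)) = (\<Prod>b\<in>Basis. integral\<^sup>L lborel (f b))"
    unfolding lborel_eq[where 'a='a] integral_distr[OF s m] e
    by (simp add: product_integral_prod f)
qed

definition dens :: "real \<Rightarrow> real" where
  "dens s = indicator {0<..<1} s * (2 * (sin (pi * s))\<^sup>2)"

text \<open>The geometric mean of \<open>dens s\<close> and \<open>dens (s + \<delta>)\<close>. When
  both points lie in the unit interval, these densities are \<open>affinity\<close> times exp of
  plus or minus \<open>log_ratio\<close>, which is half the log-likelihood ratio.\<close>

definition affinity :: "real \<Rightarrow> real \<Rightarrow> real" where
  "affinity \<delta> s = indicator {0<..<1} s * indicator {0<..<1} (s + \<delta>) * (2 * sin (pi * s) * sin (pi * (s + \<delta>)))"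

definition log_ratio :: "real \<Rightarrow> real \<Rightarrow> real" where
  "log_ratio \<delta> s = ln (sin (pi * s)) - ln (sin (pi * (s + \<delta>)))"

lemma affinity_measurable [measurable]: "affinity \<delta> \<in> borel_measurable borel"
  unfolding affinity_def[abs_def] by measurable

lemma log_ratio_measurable [measurable]: "log_ratio \<delta> \<in> borel_measurable borel"
  unfolding log_ratio_def[abs_def] by measurable

lemma dens_measurable [measurable]: "dens \<in> borel_measurable borel"
  unfolding dens_def[abs_def] by measurable

lemma sin_pi_mult_pos: "0 < s \<Longrightarrow> s < 1 \<Longrightarrow> 0 < sin (pi * s)"
  by (intro sin_gt_zero) auto

lemma affinity_nonneg: "0 \<le> affinity \<delta> s"
  using sin_pi_mult_pos[of s] sin_pi_mult_pos[of "s + \<delta>"]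
  by (auto simp: affinity_def indicator_def)

lemma dens_nonneg: "0 \<le> dens s"
  by (simp add: dens_def indicator_def)

lemma affinity_integrable:
  "integrable lborel (\<lambda>s. of_real (affinity \<delta> s) * cis (t * log_ratio \<delta> s))"
proof (rule Bochner_Integration.integrable_bound)
  show "integrable lborel (\<lambda>s::real. 2 * indicator {0..1} s :: real)"
    by (intro integrable_mult_right integrable_real_indicator) auto
  show "(\<lambda>s. of_real (affinity \<delta> s) * cis (t * log_ratio \<delta> s)) \<in> borel_measurable lborel"
    by measurable
  have "\<bar>affinity \<delta> s\<bar> \<le> \<bar>2 * indicator {0..1} s\<bar>" for s :: real
    by (auto simp: affinity_def indicator_def abs_mult intro!: mult_le_one)
  then show "AE s in lborel. norm (of_real (affinity \<delta> s) * cis (t * log_ratio \<delta> s)) \<le> norm (2 * indicator {0..1} s :: real)"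
    by (intro AE_I2) (simp add: norm_mult)
qed

text \<open>A negative shift becomes positive by moving the integration variable. This exchanges the
  two sines in the ratio, and the resulting sign of t is absorbed by the evenness of
  \<open>chi\<close>.\<close>

lemma integral_affinity:
  assumes "\<bar>\<delta>\<bar> < 1" "t \<noteq> 0"
  shows "(\<integral>s. of_real (affinity \<delta> s) * cis (t * log_ratio \<delta> s) \<partial>lborel) = of_real (chi (pi * \<bar>\<delta>\<bar>) t)"
proof -
  have pos: "(\<integral>s. of_real (affinity \<delta> s) * cis (t * log_ratio \<delta> s) \<partial>lborel) = of_real (chi (pi * \<delta>) t)"
    if d: "0 \<le> \<delta>" "\<delta> < 1" and "t \<noteq> 0" for \<delta> t
  proof -
    have "of_real (chi (pi * \<delta>) t) = (\<integral>s. indicator {0<..<1 - (pi * \<delta>) / pi} s *\<^sub>R (of_real (2 * sin (pi * s) * sin (pi * s + pi * \<delta>)) * cis (t * (ln (sin (pi * s)) - ln (sin (pi * s + pi * \<delta>))))) \<partial>lborel)"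
      using d \<open>t \<noteq> 0\<close> by (intro integral_eq_chi[symmetric]) auto
    also have "\<dots> = (\<integral>s. of_real (affinity \<delta> s) * cis (t * log_ratio \<delta> s) \<partial>lborel)"
      using d by (intro Bochner_Integration.integral_cong refl)
        (auto simp: affinity_def log_ratio_def indicator_def distrib_left)
    finally show ?thesis by simp
  qed
  show ?thesis
  proof (cases "0 \<le> \<delta>")
    case True
    then show ?thesis using pos assms by simp
  next
    case False
    have "(\<integral>s. of_real (affinity \<delta> s) * cis (t * log_ratio \<delta> s) \<partial>lborel) =
      (\<integral>s. of_real (affinity \<delta> (- \<delta> + 1 * s)) * cis (t * log_ratio \<delta> (- \<delta> + 1 * s)) \<partial>lborel)"
      by (subst lborel_integral_real_affine[where c=1 and t="- \<delta>"]) simp_all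
    also have "\<dots> = (\<integral>s. of_real (affinity (- \<delta>) s) * cis (- t * log_ratio (- \<delta>) s) \<partial>lborel)"
      by (intro Bochner_Integration.integral_cong refl)
         (simp add: affinity_def log_ratio_def algebra_simps)
    also have "\<dots> = of_real (chi (pi * (- \<delta>)) (- t))"
      using False assms by (intro pos) auto
    finally show ?thesis using False by (simp add: chi_minus)
  qed
qed

lemma integral_dens: "integrable lborel dens" "integral\<^sup>L lborel dens = 1"
proof -
  have "has_bochner_integral lborel (\<lambda>x. (2 * (sin (pi * x))\<^sup>2) * indicator {0..1} x)
     ((1 - sin (2 * pi * 1) / (2 * pi)) - (0 - sin (2 * pi * 0) / (2 * pi)))"
  proof (rule has_bochner_integral_FTC_Icc_nonneg[where F="\<lambda>x. x - sin (2 * pi * x) / (2 * pi)"])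
    fix x :: real
    have "2 * (sin (pi * x))\<^sup>2 = 1 - cos (2 * (pi * x))" by (simp add: cos_double_sin)
    then show "DERIV (\<lambda>x. x - sin (2 * pi * x) / (2 * pi)) x :> 2 * (sin (pi * x))\<^sup>2"
      by (auto intro!: derivative_eq_intros simp: mult_ac)
  qed auto
  moreover have "AE x in lborel. (2 * (sin (pi * x))\<^sup>2) * indicator {0..1} x = dens x"
    using AE_lborel_singleton[of "0::real"] AE_lborel_singleton[of "1::real"]
    by eventually_elim (auto simp: dens_def indicator_def)
  ultimately have "has_bochner_integral lborel dens 1"
    by (subst (asm) has_bochner_integral_cong_AE[where g=dens]) auto
  then show "integrable lborel dens" "integral\<^sup>L lborel dens = 1"
    by (auto simp: has_bochner_integral_iff)
qed

definition pdens :: "'a::euclidean_space \<Rightarrow> real" where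
  "pdens x = (\<Prod>b\<in>Basis. dens (x \<bullet> b))"

lemma pdens_measurable [measurable]: "pdens \<in> borel_measurable borel"
  unfolding pdens_def[abs_def] by measurable

lemma pdens_nonneg: "0 \<le> pdens x"
  unfolding pdens_def by (intro prod_nonneg dens_nonneg ballI)

lemma integral_pdens: "integrable lborel (pdens :: 'a::euclidean_space \<Rightarrow> real)"
  "integral\<^sup>L lborel (pdens :: 'a::euclidean_space \<Rightarrow> real) = 1"
  using lborel_product_integral[of "\<lambda>_::'a. dens"] integral_dens unfolding pdens_def[abs_def] by auto

text \<open>On the common support the two densities are W exp Y and W exp (-Y), where W is the
  product of affinities and Y the sum of log ratios, so the smaller one is W exp (-\<bar>Y\<bar>).
  Elsewhere the left side vanishes.\<close>

lemma min_pdens_ge: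
  fixes x y :: "'a::euclidean_space"
  shows "(\<Prod>b\<in>Basis. affinity (y \<bullet> b) (x \<bullet> b)) * exp (- \<bar>\<Sum>b\<in>Basis. log_ratio (y \<bullet> b) (x \<bullet> b)\<bar>)
    \<le> min (pdens x) (pdens (x + y))"
proof (cases "\<exists>b\<in>Basis. affinity (y \<bullet> b) (x \<bullet> b) = 0")
  case True
  then have W0: "(\<Prod>b\<in>Basis. affinity (y \<bullet> b) (x \<bullet> b)) = 0" by (auto intro: prod_zero)
  show ?thesis unfolding W0 using pdens_nonneg[of x] pdens_nonneg[of "x + y"] by simp
next
  case False
  define W where "W = (\<Prod>b\<in>Basis. affinity (y \<bullet> b) (x \<bullet> b))"
  define Y where "Y = (\<Sum>b\<in>Basis. log_ratio (y \<bullet> b) (x \<bullet> b))"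
  have W: "0 \<le> W" unfolding W_def by (intro prod_nonneg affinity_nonneg ballI)
  have in01: "0 < x \<bullet> b" "x \<bullet> b < 1" "0 < x \<bullet> b + y \<bullet> b" "x \<bullet> b + y \<bullet> b < 1" if "b \<in> Basis" for b
    using False that by (auto simp: affinity_def indicator_def split: if_splits)
  have p: "0 < sin (pi * (x \<bullet> b))" "0 < sin (pi * (x \<bullet> b + y \<bullet> b))" if "b \<in> Basis" for b
    using in01[OF that] by (auto intro: sin_pi_mult_pos)
  have "dens (x \<bullet> b) = affinity (y \<bullet> b) (x \<bullet> b) * exp (log_ratio (y \<bullet> b) (x \<bullet> b))" if "b \<in> Basis" for b
    using in01[OF that] p[OF that]
    by (simp add: dens_def affinity_def log_ratio_def exp_diff power2_eq_square)
  then have "pdens x = W * exp Y"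
    unfolding pdens_def W_def Y_def exp_sum[OF finite_Basis] prod.distrib[symmetric] by (intro prod.cong) auto
  moreover have "dens ((x + y) \<bullet> b) = affinity (y \<bullet> b) (x \<bullet> b) * exp (- log_ratio (y \<bullet> b) (x \<bullet> b))" if "b \<in> Basis" for b
    using in01[OF that] p[OF that]
    by (simp add: dens_def affinity_def log_ratio_def exp_diff power2_eq_square inner_add_left)
  then have "pdens (x + y) = W * exp (- Y)"
    unfolding pdens_def W_def Y_def sum_negf[symmetric] exp_sum[OF finite_Basis] prod.distrib[symmetric]
    by (intro prod.cong) auto
  ultimately show ?thesis
    unfolding W_def[symmetric] Y_def[symmetric] using W by (auto intro!: mult_left_mono)
qed

lemma prod_cis: "(\<Prod>b\<in>A. cis (g b)) = cis (\<Sum>b\<in>A. g b)"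
  by (induction A rule: infinite_finite_induct) (auto simp: cis_mult)

text \<open>exp (-\<bar>Y\<bar>) is a superposition of the functions cos (t Y) with positive weights
  proportional to 1 / (1 + t^2), and the integral of W cos (t Y) is a product of \<open>chi\<close>
  values. Positivity of the weights lets the pointwise bound \<open>chi_ge\<close> pass to the
  integral; shifts up to 1/2 keep every angle at most pi/2.\<close>

lemma integral_min_pdens_ge:
  fixes y :: "'a::euclidean_space"
  assumes y: "\<And>b. b \<in> Basis \<Longrightarrow> \<bar>y \<bullet> b\<bar> \<le> 1 / 2"
  shows "1 - sqrt (2 / pi) * gauss_int (sqrt (2 * (\<Sum>b\<in>Basis. h_exp (pi * \<bar>y \<bullet> b\<bar>))))
    \<le> (\<integral>x. min (pdens x) (pdens (x + y)) \<partial>lborel)"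
proof -
  define S where "S = (\<Sum>b\<in>Basis. h_exp (pi * \<bar>y \<bullet> b\<bar>))"
  have y': "pi * \<bar>y \<bullet> b\<bar> \<le> pi / 2" if "b \<in> Basis" for b
    using mult_left_mono[OF y[OF that], of pi] by simp
  have S: "0 \<le> S" unfolding S_def
    using y' h_exp_mono[of 0] by (intro sum_nonneg) force
  define W where "W x = (\<Prod>b\<in>Basis. affinity (y \<bullet> b) (x \<bullet> b))" for x
  define Y where "Y x = (\<Sum>b\<in>Basis. log_ratio (y \<bullet> b) (x \<bullet> b))" for x
  have W0: "0 \<le> W x" for x unfolding W_def by (intro prod_nonneg affinity_nonneg ballI)
  have [measurable]: "W \<in> borel_measurable borel" "Y \<in> borel_measurable borel"
    unfolding W_def[abs_def] Y_def[abs_def] by measurable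
  have WY: "of_real (W x) * cis (t * Y x) = (\<Prod>b\<in>Basis. of_real (affinity (y \<bullet> b) (x \<bullet> b)) * cis (t * log_ratio (y \<bullet> b) (x \<bullet> b)))" for x t
    by (simp add: W_def Y_def prod.distrib prod_cis sum_distrib_left)
  have intWY: "integrable lborel (\<lambda>x. of_real (W x) * cis (t * Y x))" for t
    unfolding WY by (intro lborel_product_integral affinity_integrable)
  have cf: "(\<integral>x. W x * cos (t * Y x) \<partial>lborel) = (\<Prod>b\<in>Basis. chi (pi * \<bar>y \<bullet> b\<bar>) t)" if "t \<noteq> 0" for t
  proof -
    have "(\<integral>x. of_real (W x) * cis (t * Y x) \<partial>lborel) = (\<Prod>b\<in>Basis. (\<integral>s. of_real (affinity (y \<bullet> b) s) * cis (t * log_ratio (y \<bullet> b) s) \<partial>lborel))"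
      unfolding WY by (intro lborel_product_integral affinity_integrable)
    also have "\<dots> = (\<Prod>b\<in>Basis. complex_of_real (chi (pi * \<bar>y \<bullet> b\<bar>) t))"
      using that y by (intro prod.cong refl integral_affinity) force+
    finally have "Re (\<integral>x. of_real (W x) * cis (t * Y x) \<partial>lborel) = (\<Prod>b\<in>Basis. chi (pi * \<bar>y \<bullet> b\<bar>) t)"
      by (simp flip: of_real_prod)
    then show ?thesis by (subst (asm) integral_Re[OF intWY, symmetric]) simp
  qed
  have intW: "integrable lborel W"
    using integrable_Re[OF intWY[of 0]] by simp
  have int1: "integrable lborel (\<lambda>t. 1 / (1 + t\<^sup>2) :: real)" and val1: "(\<integral>t. 1 / (1 + t\<^sup>2) \<partial>lborel) = pi"
    using has_bochner_integral_inverse_1_plus_square by (auto simp: has_bochner_integral_iff)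
  have pos1: "0 < 1 + t\<^sup>2" for t :: real by (simp add: add_pos_nonneg)
  define F where "F x t = W x * (cos (t * Y x) / (1 + t\<^sup>2))" for x t
  have measF: "case_prod F \<in> borel_measurable (lborel \<Otimes>\<^sub>M lborel)"
    unfolding F_def[abs_def] by measurable
  have "integrable (lborel \<Otimes>\<^sub>M lborel) (\<lambda>(x, t). W x * (1 / (1 + t\<^sup>2)))"
  proof (rule lborel_pair.Fubini_integrable)
    show "integrable lborel (\<lambda>x. \<integral>t. norm (case (x, t) of (x, t) \<Rightarrow> W x * (1 / (1 + t\<^sup>2))) \<partial>lborel)"
    proof -
      have "norm (W x * (1 / (1 + t\<^sup>2))) = W x * (1 / (1 + t\<^sup>2))" for x t
        using W0[of x] pos1[of t] by (simp add: abs_mult)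
      then show ?thesis
        using intW by (simp only: prod.case Bochner_Integration.integral_mult_right_zero val1 integrable_mult_left)
    qed
    show "AE x in lborel. integrable lborel (\<lambda>t. case (x, t) of (x, t) \<Rightarrow> W x * (1 / (1 + t\<^sup>2)))"
      using int1 by (intro AE_I2) (simp del: times_divide_eq_right)
  qed measurable
  then have intF: "integrable (lborel \<Otimes>\<^sub>M lborel) (case_prod F)"
  proof (rule Bochner_Integration.integrable_bound[OF _ measF])
    have "\<bar>F x t\<bar> \<le> W x * (1 / (1 + t\<^sup>2))" for x t
      unfolding F_def abs_mult abs_divide abs_of_pos[OF pos1] abs_of_nonneg[OF W0]
      using pos1[of t] by (intro mult_left_mono divide_right_mono W0) auto
    then have "norm (F x t) \<le> norm (W x * (1 / (1 + t\<^sup>2)))" for x t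
      using order_trans[OF _ abs_ge_self] by (metis real_norm_def)
    then show "AE z in lborel \<Otimes>\<^sub>M lborel. norm (case_prod F z) \<le> norm (case z of (x, t) \<Rightarrow> W x * (1 / (1 + t\<^sup>2)))"
      unfolding case_prod_unfold by (intro AE_I2)
  qed
  have fub: "(\<integral>t. (\<integral>x. F x t \<partial>lborel) \<partial>lborel) = (\<integral>x. (\<integral>t. F x t \<partial>lborel) \<partial>lborel)"
    by (rule lborel_pair.Fubini_integral[OF intF])
  have Ft: "(\<integral>t. F x t \<partial>lborel) = pi * (W x * exp (- \<bar>Y x\<bar>))" for x
    unfolding F_def Bochner_Integration.integral_mult_right_zero
    using has_bochner_integral_integral_eq[OF has_bochner_integral_cauchy_cos[of "Y x"]] by simp
  have Fx: "(\<integral>x. F x t \<partial>lborel) = (\<Prod>b\<in>Basis. chi (pi * \<bar>y \<bullet> b\<bar>) t) / (1 + t\<^sup>2)" if "t \<noteq> 0" for t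
    unfolding F_def using cf[OF that] by simp
  have gauss: "has_bochner_integral lborel (\<lambda>t. exp (- ((1 + t\<^sup>2) * S)) / (1 + t\<^sup>2)) (pi - sqrt (2 * pi) * gauss_int (sqrt (2 * S)))"
    using has_bochner_integral_cauchy_gaussian[of "sqrt (2 * S)"] S by simp
  have "pi - sqrt (2 * pi) * gauss_int (sqrt (2 * S)) = (\<integral>t. exp (- ((1 + t\<^sup>2) * S)) / (1 + t\<^sup>2) \<partial>lborel)"
    using gauss by (simp add: has_bochner_integral_iff)
  also have "\<dots> \<le> (\<integral>t. (\<integral>x. F x t \<partial>lborel) \<partial>lborel)"
  proof (rule integral_mono_AE)
    show "integrable lborel (\<lambda>t. exp (- ((1 + t\<^sup>2) * S)) / (1 + t\<^sup>2))"
      using gauss by (simp add: has_bochner_integral_iff)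
    show "integrable lborel (\<lambda>t. \<integral>x. F x t \<partial>lborel)"
      by (rule lborel_pair.integrable_snd[OF intF])
    show "AE t in lborel. exp (- ((1 + t\<^sup>2) * S)) / (1 + t\<^sup>2) \<le> (\<integral>x. F x t \<partial>lborel)"
      \<comment> \<open>The characteristic function has been identified away from t = 0 only, which
        is almost everywhere.\<close>
      using AE_lborel_singleton[of "0::real"]
    proof eventually_elim
      case (elim t)
      have "exp (- ((1 + t\<^sup>2) * S)) = (\<Prod>b\<in>Basis. exp (- ((1 + t\<^sup>2) * h_exp (pi * \<bar>y \<bullet> b\<bar>))))"
        unfolding S_def by (simp add: sum_distrib_left sum_negf[symmetric] exp_sum)
      also have "\<dots> \<le> (\<Prod>b\<in>Basis. chi (pi * \<bar>y \<bullet> b\<bar>) t)"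
        using elim y' by (intro prod_mono conjI chi_ge) auto
      finally show ?case
        unfolding Fx[OF elim] using pos1[of t] by (intro divide_right_mono) auto
    qed
  qed
  also have "\<dots> = pi * (\<integral>x. W x * exp (- \<bar>Y x\<bar>) \<partial>lborel)"
    unfolding fub Ft by simp
  also have "\<dots> \<le> pi * (\<integral>x. min (pdens x) (pdens (x + y)) \<partial>lborel)"
  proof (intro mult_left_mono integral_mono)
    show "integrable lborel (\<lambda>x. W x * exp (- \<bar>Y x\<bar>))"
      by (rule Bochner_Integration.integrable_bound[OF intW])
         (auto intro!: AE_I2 mult_left_le simp: abs_mult)
    show "integrable lborel (\<lambda>x. min (pdens x) (pdens (x + y)))"
      by (rule Bochner_Integration.integrable_bound[OF integral_pdens(1)])
         (auto intro!: AE_I2 simp: pdens_nonneg min_def)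
    show "W x * exp (- \<bar>Y x\<bar>) \<le> min (pdens x) (pdens (x + y))" for x
      unfolding W_def Y_def by (rule min_pdens_ge)
  qed simp
  finally have "1 - sqrt (2 * pi) / pi * gauss_int (sqrt (2 * S)) \<le> (\<integral>x. min (pdens x) (pdens (x + y)) \<partial>lborel)"
    by (simp add: field_simps)
  moreover have "sqrt (2 * pi) / pi = sqrt (2 / pi)"
    by (simp add: real_sqrt_divide real_sqrt_mult field_simps)
  ultimately show ?thesis by (simp add: S_def)
qed

section \<open>Averaging over the grid\<close>

definition subgraph :: "('a \<Rightarrow> real) \<Rightarrow> ('a \<times> real) set" where
  "subgraph f = {(x, u). 0 < u \<and> u < f x}"

lemma subgraph_measurable [measurable]:
  fixes f :: "'a::euclidean_space \<Rightarrow> real"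
  assumes [measurable]: "f \<in> borel_measurable borel"
  shows "subgraph f \<in> sets borel"
proof -
  have "{z \<in> space (borel \<Otimes>\<^sub>M borel). 0 < snd z \<and> snd z < f (fst z)} \<in> sets (borel \<Otimes>\<^sub>M borel)"
    by measurable
  moreover have "subgraph f = {z \<in> space (borel \<Otimes>\<^sub>M borel). 0 < snd z \<and> snd z < f (fst z)}"
    by (auto simp: subgraph_def space_pair_measure)
  ultimately show ?thesis unfolding borel_prod by (simp only:)
qed

text \<open>By Fubini: a vertical section is an interval from the minimum up to f x, open at the
  bottom where g vanishes. For probability densities the result is their total variation
  distance.\<close>

lemma emeasure_subgraph_diff:
  fixes f g :: "'a::euclidean_space \<Rightarrow> real"
  assumes [measurable]: "f \<in> borel_measurable borel" "g \<in> borel_measurable borel"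
    and "\<And>x. 0 \<le> f x" "\<And>x. 0 \<le> g x"
  shows "emeasure lborel (subgraph f - subgraph g) = (\<integral>\<^sup>+x. ennreal (f x - min (f x) (g x)) \<partial>lborel)"
proof -
  have "emeasure lborel (subgraph f - subgraph g) = emeasure (lborel \<Otimes>\<^sub>M lborel) (subgraph f - subgraph g)"
    by (simp add: lborel_prod)
  also have "\<dots> = (\<integral>\<^sup>+x. emeasure lborel (Pair x -` (subgraph f - subgraph g)) \<partial>lborel)"
  proof (rule lborel.emeasure_pair_measure_alt)
    have "subgraph f - subgraph g \<in> sets borel" by measurable
    then show "subgraph f - subgraph g \<in> sets (lborel \<Otimes>\<^sub>M lborel)"
      unfolding lborel_prod sets_lborel .
  qed
  also have "\<dots> = (\<integral>\<^sup>+x. ennreal (f x - min (f x) (g x)) \<partial>lborel)"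
  proof (intro nn_integral_cong)
    fix x
    have "Pair x -` (subgraph f - subgraph g) = (if g x = 0 then {0<..<f x} else {min (f x) (g x)..<f x})"
      using assms(3)[of x] assms(4)[of x] by (auto simp: subgraph_def)
    then show "emeasure lborel (Pair x -` (subgraph f - subgraph g)) = ennreal (f x - min (f x) (g x))"
      using assms(3)[of x] by (simp add: min_def)
  qed
  finally show ?thesis .
qed

lemma translate_subgraph: "translate (y, 0) (subgraph f) = subgraph (\<lambda>x. f (x - y))"
  by (auto simp: translate_def subgraph_def)

lemma emeasure_subgraph_pdens: "emeasure lborel (subgraph (pdens :: 'a::euclidean_space \<Rightarrow> real)) = 1"
proof -
  have "subgraph (pdens :: 'a \<Rightarrow> real) - subgraph (\<lambda>_. 0) = subgraph pdens"
    by (auto simp: subgraph_def)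
  then have "emeasure lborel (subgraph (pdens :: 'a \<Rightarrow> real)) = (\<integral>\<^sup>+x. ennreal (pdens x) \<partial>(lborel :: 'a measure))"
    using emeasure_subgraph_diff[of "pdens :: 'a \<Rightarrow> real" "\<lambda>_. 0"] by (simp add: pdens_nonneg)
  then show ?thesis
    by (simp add: nn_integral_eq_integral integral_pdens pdens_nonneg)
qed

definition tv_bound :: "'a::euclidean_space \<Rightarrow> real \<Rightarrow> real" where
  "tv_bound v r = sqrt (2 / pi) * gauss_int (sqrt (2 * (\<Sum>b\<in>Basis. h_exp (pi * (r * \<bar>v \<bullet> b\<bar>)))))"

lemma measure_subgraph_diff_le:
  fixes v :: "'a::euclidean_space"
  assumes "\<And>b. b \<in> Basis \<Longrightarrow> \<bar>r\<bar> * \<bar>v \<bullet> b\<bar> \<le> 1 / 2"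
  shows "measure lborel (subgraph pdens - translate (r *\<^sub>R v, 0) (subgraph pdens)) \<le> tv_bound v \<bar>r\<bar>"
proof -
  define y where "y = - (r *\<^sub>R v)"
  have y: "\<bar>y \<bullet> b\<bar> = \<bar>r\<bar> * \<bar>v \<bullet> b\<bar>" for b by (simp add: y_def abs_mult)
  have int: "integrable lborel (\<lambda>x. min (pdens x) (pdens (x + y)))"
    by (rule Bochner_Integration.integrable_bound[OF integral_pdens(1)])
       (auto intro!: AE_I2 simp: pdens_nonneg min_def)
  have "emeasure lborel (subgraph pdens - translate (r *\<^sub>R v, 0) (subgraph pdens)) = (\<integral>\<^sup>+x. ennreal (pdens x - min (pdens x) (pdens (x + y))) \<partial>lborel)"
    unfolding translate_subgraph by (subst emeasure_subgraph_diff) (auto simp: pdens_nonneg y_def)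
  also have "\<dots> = ennreal (\<integral>x. pdens x - min (pdens x) (pdens (x + y)) \<partial>lborel)"
    using int by (intro nn_integral_eq_integral Bochner_Integration.integrable_diff integral_pdens) auto
  also have "(\<integral>x. pdens x - min (pdens x) (pdens (x + y)) \<partial>lborel) = 1 - (\<integral>x. min (pdens x) (pdens (x + y)) \<partial>lborel)"
    using int by (simp add: integral_pdens)
  finally have "measure lborel (subgraph pdens - translate (r *\<^sub>R v, 0) (subgraph pdens)) = enn2real (ennreal (1 - (\<integral>x. min (pdens x) (pdens (x + y)) \<partial>lborel)))"
    by (simp add: measure_def)
  moreover have "0 \<le> 1 - (\<integral>x. min (pdens x) (pdens (x + y)) \<partial>lborel)"
    using integral_mono[OF int integral_pdens(1)] by (simp add: integral_pdens(2))
  moreover have "1 - (\<integral>x. min (pdens x) (pdens (x + y)) \<partial>lborel) \<le> tv_bound v \<bar>r\<bar>"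
    using integral_min_pdens_ge[of y] assms by (simp add: y tv_bound_def)
  ultimately show ?thesis by simp
qed

text \<open>A distance k \<ge> 1 is realised by 2 (m - k) ordered pairs, the distance 0 by m.
  Counting the diagonal twice makes the formula uniform, at no cost in the application, where \<phi>
  vanishes at 0.\<close>

lemma sum_abs_diff_le:
  fixes \<phi> :: "nat \<Rightarrow> real"
  assumes "0 \<le> \<phi> 0"
  shows "(\<Sum>i<m. \<Sum>j<m. \<phi> (nat \<bar>int j - int i\<bar>)) \<le> 2 * (\<Sum>k<m. (real m - real k) * \<phi> k)"
proof (induction m)
  case (Suc m)
  have 1: "(\<Sum>i<m. \<phi> (nat \<bar>int m - int i\<bar>)) = (\<Sum>k<m. \<phi> (Suc k))"
    by (subst sum.nat_diff_reindex[symmetric]) (intro sum.cong refl arg_cong[where f=\<phi>], auto)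
  have 2: "(\<Sum>i<m. \<phi> (nat \<bar>int i - int m\<bar>)) = (\<Sum>k<m. \<phi> (Suc k))"
    by (subst sum.nat_diff_reindex[symmetric]) (intro sum.cong refl arg_cong[where f=\<phi>], auto)
  have "(\<Sum>i<Suc m. \<Sum>j<Suc m. \<phi> (nat \<bar>int j - int i\<bar>)) = (\<Sum>i<m. \<Sum>j<m. \<phi> (nat \<bar>int j - int i\<bar>)) + 2 * (\<Sum>k<m. \<phi> (Suc k)) + \<phi> 0"
    using 1 2 by (simp add: sum.distrib)
  also have "\<dots> \<le> 2 * (\<Sum>k<m. (real m - real k) * \<phi> k) + 2 * (\<Sum>k<m. \<phi> (Suc k)) + 2 * \<phi> 0"
    using Suc assms by simp
  also have "\<dots> = 2 * (\<Sum>k<m. (real m - real k) * \<phi> k) + 2 * (\<Sum>k<Suc m. \<phi> k)"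
    by (subst sum.lessThan_Suc_shift) simp
  also have "\<dots> = 2 * (\<Sum>k<Suc m. (real (Suc m) - real k) * \<phi> k)"
    by (simp add: algebra_simps sum.distrib sum_subtractf)
  finally show ?case .
qed simp

text \<open>Left endpoints underestimate the increasing n but overestimate the decreasing weight.
  Over a cell of length 3/m the weight drops by at most 1/m and n is at most 1, whence the extra 1/m
  in the integrand. Stopping at K allows induction.\<close>

lemma riemann_sum_le:
  fixes n :: "real \<Rightarrow> real"
  assumes m: "0 < m" and cont: "continuous_on {0..3} n"
    and mono: "\<And>r s. 0 \<le> r \<Longrightarrow> r \<le> s \<Longrightarrow> s \<le> 3 \<Longrightarrow> n r \<le> n s"
    and bnd: "\<And>r. 0 \<le> r \<Longrightarrow> r \<le> 3 \<Longrightarrow> 0 \<le> n r \<and> n r \<le> 1"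
    and "K \<le> m"
  shows "(\<Sum>k<K. (real m - real k) * n (3 * real k / real m)) * (3 / (real m)\<^sup>2)
    \<le> integral {0..3 * real K / real m} (\<lambda>r. (1 - r / 3) * n r + 1 / real m)"
  using \<open>K \<le> m\<close>
proof (induction K)
  case (Suc K)
  let ?g = "\<lambda>r. (1 - r / 3) * n r + 1 / real m"
  define a b where "a = 3 * real K / real m" and "b = 3 * real (Suc K) / real m"
  have ab: "0 \<le> a" "a \<le> b" "b \<le> 3" using Suc m by (auto simp: a_def b_def field_simps)
  have int: "?g integrable_on {c..d}" if "0 \<le> c" "d \<le> 3" for c d
    using that by (intro integrable_continuous_real continuous_intros continuous_on_subset[OF cont]) auto
  have "(real m - real K) * n a * (3 / (real m)\<^sup>2) = (b - a) * ((1 - a / 3) * n a)"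
    using m by (simp add: a_def b_def power2_eq_square field_simps)
  also have "\<dots> = integral {a..b} (\<lambda>_. (1 - a / 3) * n a)"
    using ab by simp
  also have "\<dots> \<le> integral {a..b} ?g"
  proof (rule integral_le)
    fix r assume r: "r \<in> {a..b}"
    have "(1 - a / 3) * n a = (1 - r / 3) * n a + (r / 3 - a / 3) * n a" by (simp add: algebra_simps)
    also have "\<dots> \<le> (1 - r / 3) * n r + 1 / real m * 1"
    proof (intro add_mono mult_mono)
      show "r / 3 - a / 3 \<le> 1 / real m"
      proof -
        have "r / 3 \<le> real (Suc K) / real m" using r unfolding b_def by (simp del: of_nat_Suc add: mult.commute)
        moreover have "a / 3 = real K / real m" by (simp add: a_def)
        ultimately show ?thesis by (simp add: add_divide_distrib)
      qed
    qed (use r ab mono[of a r] bnd[of a] m in auto)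
    finally show "(1 - a / 3) * n a \<le> ?g r" by simp
  qed (use ab int in auto)
  finally have "(real m - real K) * n a * (3 / (real m)\<^sup>2) \<le> integral {a..b} ?g" .
  moreover have "(\<Sum>k<K. (real m - real k) * n (3 * real k / real m)) * (3 / (real m)\<^sup>2) \<le> integral {0..a} ?g"
    using Suc by (simp add: a_def)
  moreover have "integral {0..a} ?g + integral {a..b} ?g = integral {0..b} ?g"
    using ab int by (intro Henstock_Kurzweil_Integration.integral_combine) auto
  ultimately show ?case
    unfolding sum.lessThan_Suc distrib_right a_def[symmetric] b_def[symmetric] by linarith
qed simp

section \<open>Comparison with the Gaussian shift and its average\<close>

lemma gauss_int_strict_mono: "x < y \<Longrightarrow> gauss_int x < gauss_int y"
  by (rule DERIV_pos_imp_increasing) (auto intro!: DERIV_gauss_int)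

lemma gauss_int_mono: "x \<le> y \<Longrightarrow> gauss_int x \<le> gauss_int y"
  using gauss_int_strict_mono[of x y] by (cases "x = y") auto

lemma gauss_int_continuous: "continuous_on S gauss_int"
  by (intro continuous_at_imp_continuous_on ballI DERIV_isCont[OF DERIV_gauss_int])

lemma gauss_int_le: "gauss_int x \<le> sqrt (pi / 2)"
  by (rule tendsto_lowerbound[OF gauss_int_at_top])
     (auto intro: gauss_int_mono eventually_mono[OF eventually_ge_at_top[of x]])

text \<open>For nonnegative x, the total variation distance between the unit normal laws with means
  x and -x.\<close>

definition normal_tv :: "real \<Rightarrow> real" where
  "normal_tv x = sqrt (2 / pi) * gauss_int x"

lemma normal_tv_le_1: "normal_tv x \<le> 1"
proof -
  have "normal_tv x \<le> sqrt (2 / pi) * sqrt (pi / 2)"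
    unfolding normal_tv_def by (intro mult_left_mono gauss_int_le) auto
  also have "\<dots> = 1" by (simp add: real_sqrt_mult[symmetric])
  finally show ?thesis .
qed

lemma normal_tv_mono: "x \<le> y \<Longrightarrow> normal_tv x \<le> normal_tv y"
  unfolding normal_tv_def by (intro mult_left_mono gauss_int_mono) auto

lemma normal_tv_strict_mono: "x < y \<Longrightarrow> normal_tv x < normal_tv y"
  unfolding normal_tv_def by (intro mult_strict_left_mono gauss_int_strict_mono) auto

lemma normal_tv_0 [simp]: "normal_tv 0 = 0" by (simp add: normal_tv_def)

lemma normal_tv_continuous: "continuous_on S normal_tv"
  unfolding normal_tv_def by (intro continuous_intros gauss_int_continuous)

lemma DERIV_normal_tv: "DERIV normal_tv x :> sqrt (2 / pi) * exp (- x\<^sup>2 / 2)"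
  unfolding normal_tv_def by (intro DERIV_cmult DERIV_gauss_int)

lemma tv_bound_eq: "tv_bound v r = normal_tv (sqrt (2 * (\<Sum>b\<in>Basis. h_exp (pi * (r * \<bar>v \<bullet> b\<bar>)))))"
  by (simp add: tv_bound_def normal_tv_def)

context
  fixes v :: "'a::euclidean_space"
  assumes v: "\<And>b. b \<in> Basis \<Longrightarrow> \<bar>v \<bullet> b\<bar> \<le> 1 / 6"
begin

text \<open>The reason for the bound 1/6: shifts by up to 3 then keep the angle within [0, pi/2],
  where \<open>h_exp\<close> is controlled.\<close>

lemma arg_le: "b \<in> Basis \<Longrightarrow> 0 \<le> r \<Longrightarrow> r \<le> 3 \<Longrightarrow> pi * (r * \<bar>v \<bullet> b\<bar>) \<le> pi / 2"
  using mult_mono[of r 3 "\<bar>v \<bullet> b\<bar>" "1 / 6"] v[of b] by simp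

lemma tv_bound_mono:
  assumes "0 \<le> r" "r \<le> s" "s \<le> 3"
  shows "tv_bound v r \<le> tv_bound v s"
  unfolding tv_bound_eq using assms arg_le[of _ s]
  by (intro normal_tv_mono real_sqrt_le_mono mult_left_mono sum_mono h_exp_mono mult_right_mono) auto

lemma tv_bound_nonneg:
  assumes "0 \<le> r" "r \<le> 3"
  shows "0 \<le> tv_bound v r"
  using tv_bound_mono[of 0 r] assms by (simp add: tv_bound_eq)

lemma tv_bound_continuous: "continuous_on {0..3} (tv_bound v)"
  unfolding tv_bound_eq[abs_def]
proof (rule continuous_on_compose2[OF normal_tv_continuous[of UNIV]])
  show "continuous_on {0..3} (\<lambda>r. sqrt (2 * (\<Sum>b\<in>Basis. h_exp (pi * (r * \<bar>v \<bullet> b\<bar>)))))"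
  proof (intro continuous_intros)
    fix b :: 'a assume "b \<in> Basis"
    then show "continuous_on {0..3} (\<lambda>r. h_exp (pi * (r * \<bar>v \<bullet> b\<bar>)))"
      using arg_le by (intro continuous_on_compose2[OF h_exp_continuous] continuous_intros) auto
  qed
qed auto

text \<open>The distance of two independent uniform points of [0,3] has density 2/3 (1 - r/3), which
  gives the main term; 2 m is the Riemann sum error.\<close>

lemma spread_le:
  assumes m: "0 < m"
  shows "spread m (subgraph pdens) (v, 0) \<le> (2 / 3 * integral {0..3} (\<lambda>r. (1 - r / 3) * tv_bound v r)) * (real m)\<^sup>2 + 2 * real m"
proof -
  define J where "J = integral {0..3} (\<lambda>r. (1 - r / 3) * tv_bound v r)"
  define \<phi> where "\<phi> k = tv_bound v (3 * real k / real m)" for k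
  have "spread m (subgraph pdens) (v, 0) = (\<Sum>i<m. \<Sum>j<m. measure lborel (subgraph pdens - translate ((3 * (real j - real i) / real m) *\<^sub>R v, 0) (subgraph pdens)))"
    by (simp add: spread_def[OF subgraph_measurable[OF pdens_measurable]] emeasure_subgraph_pdens)
  also have "\<dots> \<le> (\<Sum>i<m. \<Sum>j<m. \<phi> (nat \<bar>int j - int i\<bar>))"
  proof (intro sum_mono)
    fix i j assume ij: "i \<in> {..<m}" "j \<in> {..<m}"
    define r where "r = 3 * (real j - real i) / real m"
    have r: "\<bar>r\<bar> = 3 * real (nat \<bar>int j - int i\<bar>) / real m"
    proof -
      have "real (nat \<bar>int j - int i\<bar>) = \<bar>real j - real i\<bar>" by (simp add: of_nat_nat)
      then show ?thesis unfolding r_def abs_divide abs_mult by simp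
    qed
    have "real (nat \<bar>int j - int i\<bar>) \<le> real m" using ij by auto
    then have "\<bar>r\<bar> \<le> 3" unfolding r using m by (simp add: field_simps)
    then have "\<bar>r\<bar> * \<bar>v \<bullet> b\<bar> \<le> 1 / 2" if "b \<in> Basis" for b
      using mult_mono[of "\<bar>r\<bar>" 3 "\<bar>v \<bullet> b\<bar>" "1 / 6"] v[OF that] by simp
    from measure_subgraph_diff_le[OF this]
    show "measure lborel (subgraph pdens - translate ((3 * (real j - real i) / real m) *\<^sub>R v, 0) (subgraph pdens)) \<le> \<phi> (nat \<bar>int j - int i\<bar>)"
      unfolding \<phi>_def r[symmetric] r_def by simp
  qed
  also have "\<dots> \<le> 2 * (\<Sum>k<m. (real m - real k) * \<phi> k)"
    by (rule sum_abs_diff_le) (simp add: \<phi>_def tv_bound_nonneg)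
  also have "(\<Sum>k<m. (real m - real k) * \<phi> k) \<le> (J + 3 / real m) * ((real m)\<^sup>2 / 3)"
  proof -
    have int: "(\<lambda>r. (1 - r / 3) * tv_bound v r) integrable_on {0..3}"
      by (intro integrable_continuous_real) (auto intro!: continuous_intros tv_bound_continuous)
    have "(\<Sum>k<m. (real m - real k) * tv_bound v (3 * real k / real m)) * (3 / (real m)\<^sup>2)
       \<le> integral {0..3 * real m / real m} (\<lambda>r. (1 - r / 3) * tv_bound v r + 1 / real m)"
      using m by (intro riemann_sum_le tv_bound_continuous tv_bound_mono)
        (auto simp: tv_bound_nonneg, simp add: tv_bound_eq normal_tv_le_1)
    also have "\<dots> = J + 3 / real m"
    proof -
      have "integral {0..3} (\<lambda>r. (1 - r / 3) * tv_bound v r + 1 / real m) = J + integral {0..3} (\<lambda>_::real. 1 / real m)"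
        unfolding J_def by (rule Henstock_Kurzweil_Integration.integral_add[OF int]) (rule integrable_const_ivl)
      then show ?thesis using m by simp
    qed
    finally show ?thesis using m by (simp add: \<phi>_def field_simps)
  qed
  also have "2 * ((J + 3 / real m) * ((real m)\<^sup>2 / 3)) = (2 / 3 * J) * (real m)\<^sup>2 + 2 * real m"
    using m by (simp add: power2_eq_square distrib_right)
  finally show ?thesis by (simp add: J_def)
qed

end

text \<open>Replacing \<open>h_exp\<close> by half the square makes the coordinates add up to the
  squared Euclidean norm. A nonzero coordinate makes this strict; for v = 0 strictness comes from 0
  < r.\<close>

lemma tv_bound_less:
  fixes v :: "'a::euclidean_space"
  assumes v: "norm v \<le> 1 / C" and C: "6 \<le> C" and r: "0 < r" "r \<le> 3"
  shows "tv_bound v r < normal_tv (pi * r / C)"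
proof -
  have vb: "\<bar>v \<bullet> b\<bar> \<le> 1 / 6" if "b \<in> Basis" for b
    using Basis_le_norm[OF that, of v] v C by (smt (verit) frac_le)
  have "(\<Sum>b\<in>Basis. h_exp (pi * (r * \<bar>v \<bullet> b\<bar>))) < (pi * r / C)\<^sup>2 / 2"
  proof (cases "v = 0")
    case True
    then show ?thesis using r C by simp
  next
    case False
    then obtain c where c: "c \<in> Basis" "v \<bullet> c \<noteq> 0"
      using euclidean_all_zero_iff by blast
    have h: "h_exp x \<le> x\<^sup>2 / 2" if "0 \<le> x" "x \<le> pi / 2" for x
      using h_exp_less[of x] that by (cases "x = 0") auto
    have "(\<Sum>b\<in>Basis. h_exp (pi * (r * \<bar>v \<bullet> b\<bar>))) < (\<Sum>b\<in>Basis. (pi * (r * \<bar>v \<bullet> b\<bar>))\<^sup>2 / 2)"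
    proof (rule sum_strict_mono_ex1)
      show "\<forall>b\<in>Basis. h_exp (pi * (r * \<bar>v \<bullet> b\<bar>)) \<le> (pi * (r * \<bar>v \<bullet> b\<bar>))\<^sup>2 / 2"
        using arg_le[OF vb] r by (intro ballI h) auto
      show "\<exists>b\<in>Basis. h_exp (pi * (r * \<bar>v \<bullet> b\<bar>)) < (pi * (r * \<bar>v \<bullet> b\<bar>))\<^sup>2 / 2"
        using arg_le[OF vb] r c by (intro bexI[of _ c] h_exp_less) auto
    qed simp
    also have "\<dots> = (pi * r)\<^sup>2 / 2 * (norm v)\<^sup>2"
      by (simp add: power2_norm_eq_inner euclidean_inner[of v v] sum_distrib_left power_mult_distrib power2_eq_square[of "v \<bullet> _"] mult.assoc)
    also have "\<dots> \<le> (pi * r)\<^sup>2 / 2 * (1 / C)\<^sup>2"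
      using v by (intro mult_left_mono power_mono) auto
    also have "\<dots> = (pi * r / C)\<^sup>2 / 2" by (simp add: power_divide)
    finally show ?thesis .
  qed
  then have "sqrt (2 * (\<Sum>b\<in>Basis. h_exp (pi * (r * \<bar>v \<bullet> b\<bar>)))) < sqrt ((pi * r / C)\<^sup>2)"
    by (intro real_sqrt_less_mono) simp
  also have "\<dots> = pi * r / C" using r C by simp
  finally show ?thesis unfolding tv_bound_eq by (rule normal_tv_strict_mono)
qed

text \<open>Integration by parts: (1 - r/3)^2 times \<open>normal_tv\<close> vanishes at both ends
  of [0,3], so the integral becomes one against the Gaussian density.\<close>

lemma integral_normal_tv:
  assumes C: "0 < C"
  shows "integral {0..3} (\<lambda>r. (1 - r / 3) * normal_tv (pi * r / C)) = cos_lhs C / 2"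
proof -
  define N' where "N' r = pi / C * (sqrt (2 / pi) * exp (- (pi\<^sup>2 * r\<^sup>2 / (2 * C\<^sup>2))))" for r
  have dN: "((\<lambda>r. normal_tv (pi * r / C)) has_real_derivative N' r) (at r within S)" for r S
  proof -
    have "((\<lambda>r. normal_tv (pi * r / C)) has_real_derivative (sqrt (2 / pi) * exp (- (pi * r / C)\<^sup>2 / 2)) * (pi / C)) (at r within S)"
      by (rule DERIV_chain2[OF DERIV_normal_tv]) (use C in \<open>auto intro!: derivative_eq_intros\<close>)
    then show ?thesis
      by (rule DERIV_cong) (simp add: N'_def power_divide power_mult_distrib)
  qed
  have "((\<lambda>r. (1 - r / 3)\<^sup>2 * N' r - 2 / 3 * ((1 - r / 3) * normal_tv (pi * r / C))) has_integral
     (1 - 3 / 3)\<^sup>2 * normal_tv (pi * 3 / C) - (1 - 0 / 3)\<^sup>2 * normal_tv (pi * 0 / C)) {0..3}"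
  proof (rule fundamental_theorem_of_calculus)
    fix r :: real assume "r \<in> {0..3}"
    have "((\<lambda>r. (1 - r / 3)\<^sup>2) has_real_derivative - 2 / 3 * (1 - r / 3)) (at r within {0..3})"
      by (auto intro!: derivative_eq_intros simp: field_simps)
    from DERIV_mult'[OF this dN]
    show "((\<lambda>r. (1 - r / 3)\<^sup>2 * normal_tv (pi * r / C)) has_vector_derivative (1 - r / 3)\<^sup>2 * N' r - 2 / 3 * ((1 - r / 3) * normal_tv (pi * r / C))) (at r within {0..3})"
      unfolding has_real_derivative_iff_has_vector_derivative[symmetric]
      by (rule DERIV_cong) (simp add: field_simps)
  qed simp
  then have 0: "integral {0..3} (\<lambda>r. (1 - r / 3)\<^sup>2 * N' r - 2 / 3 * ((1 - r / 3) * normal_tv (pi * r / C))) = 0"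
    by (simp add: integral_unique)
  have "integral {0..3} (\<lambda>r. (1 - r / 3)\<^sup>2 * N' r) = 2 / 3 * integral {0..3} (\<lambda>r. (1 - r / 3) * normal_tv (pi * r / C))"
    using 0 C unfolding N'_def
    by (subst (asm) integral_diff)
       (auto intro!: integrable_continuous_real continuous_intros continuous_on_compose2[OF normal_tv_continuous[of UNIV]])
  moreover have "integral {0..3} (\<lambda>r. (1 - r / 3)\<^sup>2 * N' r) = pi / C * sqrt (2 / pi) * integral {0..3} (\<lambda>r. (1 - r / 3)\<^sup>2 * exp (- (pi\<^sup>2 * r\<^sup>2 / (2 * C\<^sup>2))))"
    unfolding N'_def by (subst integral_mult_right[symmetric]) (simp add: mult_ac)
  moreover have "pi * sqrt (2 / pi) = sqrt (2 * pi)"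
    by (simp add: real_sqrt_divide real_sqrt_mult field_simps)
  ultimately show ?thesis
    using C by (simp add: cos_lhs_def field_simps)
qed

text \<open>The value 1/2 is the threshold 1/3 divided by the factor 2/3 in the density of the
  distance.\<close>

lemma integral_tv_bound_less:
  fixes v :: "'a::euclidean_space"
  assumes v: "norm v \<le> 1 / C" and C: "6 \<le> C" and "cos_lhs C \<le> 1"
  shows "integral {0..3} (\<lambda>r. (1 - r / 3) * tv_bound v r) < 1 / 2"
proof -
  have vb: "\<bar>v \<bullet> b\<bar> \<le> 1 / 6" if "b \<in> Basis" for b
    using Basis_le_norm[OF that, of v] v C by (smt (verit) frac_le)
  have "integral {0..3} (\<lambda>r. (1 - r / 3) * tv_bound v r) < integral {0..3} (\<lambda>r. (1 - r / 3) * normal_tv (pi * r / C))"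
  proof (rule integral_less_real)
    show "continuous_on {0..3} (\<lambda>r. (1 - r / 3) * tv_bound v r)"
      using vb by (auto intro!: continuous_intros tv_bound_continuous)
    show "continuous_on {0..3} (\<lambda>r. (1 - r / 3) * normal_tv (pi * r / C))"
      using C by (intro continuous_intros continuous_on_compose2[OF normal_tv_continuous[of UNIV]]) auto
    show "(1 - r / 3) * tv_bound v r < (1 - r / 3) * normal_tv (pi * r / C)" if "r \<in> {0<..<3}" for r
      using that tv_bound_less[OF v C, of r] by (intro mult_strict_left_mono) auto
  qed auto
  also have "\<dots> \<le> 1 / 2"
    using integral_normal_tv[of C] C assms(3) by simp
  finally show ?thesis .
qed

theorem signed_sum_infnorm_less:
  fixes v :: "nat \<Rightarrow> 'a::euclidean_space"
  assumes C: "6 \<le> C" "cos_lhs C \<le> 1" and v: "\<And>j. j \<in> {1..n} \<Longrightarrow> norm (v j) \<le> 1"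
  shows "\<exists>\<epsilon> :: nat \<Rightarrow> real. (\<forall>j\<in>{1..n}. \<epsilon> j \<in> {-1, 1}) \<and> infnorm (\<Sum>j=1..n. \<epsilon> j *\<^sub>R v j) < C"
proof -
  define w where "w j = v (Suc j) /\<^sub>R C" for j
  have w: "norm (w j) \<le> 1 / C" if "j < n" for j
    using v[of "Suc j"] that C by (simp add: w_def divide_simps)
  \<comment> \<open>The vectors move only the base point of the subgraph and leave the height
    alone.\<close>
  define vs where "vs = map (\<lambda>j. (w j, 0::real)) [0..<n]"
  define J where "J j = integral {0..3} (\<lambda>r. (1 - r / 3) * tv_bound (w j) r)" for j
  have J: "J j < 1 / 2" if "j < n" for j
    unfolding J_def by (rule integral_tv_bound_less[OF w[OF that] C])
  \<comment> \<open>A common slack for finitely many strict inequalities; inserting 1/2 keeps the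
    minimum meaningful for n = 0.\<close>
  define \<eta> where "\<eta> = Min (insert (1 / 2) ((\<lambda>j. 1 / 2 - J j) ` {..<n}))"
  have \<eta>: "0 < \<eta>" "\<And>j. j < n \<Longrightarrow> J j \<le> 1 / 2 - \<eta>"
    using J by (auto simp: \<eta>_def) (smt (verit) Min_le finite_imageI finite_insert finite_lessThan image_eqI insertCI lessThan_iff)
  \<comment> \<open>The combined error 3 m must not exceed the gain 2/3 \<eta> m^2.\<close>
  obtain m where m: "9 / (2 * \<eta>) < real m" using reals_Archimedean2 by blast
  then have m0: "0 < m" using \<eta>(1) by (metis divide_pos_pos less_trans mult_pos_pos of_nat_0_less_iff zero_less_numeral)
  define B where "B = subgraph (pdens :: 'a \<Rightarrow> real)"
  have B: "B \<in> sets borel" "emeasure lborel B < \<infinity>" "measure lborel B = 1"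
    by (simp_all add: B_def emeasure_subgraph_pdens measure_def)
  \<comment> \<open>A cylinder over the open unit cube, convex in the space of the subgraph, with
    free height.\<close>
  define H where "H = {z :: 'a \<times> real. \<forall>b\<in>Basis. 0 < fst z \<bullet> b \<and> fst z \<bullet> b < 1}"
  have H: "H = (\<Inter>b\<in>Basis. {z. (b, 0) \<bullet> z > 0} \<inter> {z. (b, 0) \<bullet> z < 1})"
    by (auto simp: H_def inner_commute)
  have "convex H"
    unfolding H by (intro convex_INT convex_Int convex_halfspace_gt convex_halfspace_lt)
  have "B \<subseteq> H"
  proof
    fix z assume "z \<in> B"
    then have "0 < pdens (fst z)" by (auto simp: B_def subgraph_def)
    then have "dens (fst z \<bullet> b) \<noteq> 0" if "b \<in> Basis" for b
      using that unfolding pdens_def by (metis finite_Basis less_irrefl prod_zero)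
    then show "z \<in> H" by (auto simp: H_def dens_def indicator_def split: if_splits)
  qed
  have "\<exists>e p q. (\<forall>j. e j \<in> {-1, 1::real}) \<and> p \<in> H \<and> q \<in> H \<and> p - q = (\<Sum>j<length vs. e j *\<^sub>R vs ! j)"
  proof (rule signed_sum_in_difference_body[OF B(1,2) m0 \<open>convex H\<close> \<open>B \<subseteq> H\<close>])
    fix z assume "z \<in> set vs"
    then obtain j where j: "j < n" "z = (w j, 0)" by (auto simp: vs_def)
    have wb: "\<bar>w j \<bullet> b\<bar> \<le> 1 / 6" if "b \<in> Basis" for b
      using Basis_le_norm[OF that, of "w j"] w[OF j(1)] C by (smt (verit) frac_le)
    have "spread m B z \<le> (2 / 3 * J j) * (real m)\<^sup>2 + 2 * real m"
      unfolding j(2) B_def J_def by (rule spread_le[OF wb m0])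
    also have "\<dots> \<le> (2 / 3 * (1 / 2 - \<eta>)) * (real m)\<^sup>2 + 2 * real m"
      using \<eta>(2)[OF j(1)] by (intro add_mono mult_right_mono) auto
    also have "\<dots> \<le> (real m)\<^sup>2 / 3 - real m"
    proof -
      have "9 \<le> 2 * \<eta> * real m" using m \<eta>(1) by (simp add: field_simps)
      then have "9 * real m \<le> 2 * \<eta> * real m * real m" by (intro mult_right_mono) auto
      moreover have "(2 / 3 * (1 / 2 - \<eta>)) * (real m)\<^sup>2 = (real m)\<^sup>2 / 3 - 2 / 3 * (\<eta> * real m * real m)"
        by (simp add: power2_eq_square field_simps)
      ultimately show ?thesis by linarith
    qed
    finally show "spread m B z \<le> ((real m)\<^sup>2 / 3 - real m) * measure lborel B" by (simp add: B(3))
  qed (simp add: B(3))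
  then obtain e p q where e: "\<And>j. e j \<in> {-1, 1::real}" and pq: "p \<in> H" "q \<in> H"
    and eq: "p - q = (\<Sum>j<length vs. e j *\<^sub>R vs ! j)" by blast
  define x where "x = (\<Sum>j<n. e j *\<^sub>R w j)"
  have "fst (p - q) = x"
    unfolding eq by (simp add: vs_def x_def fst_sum)
  then have xb: "\<bar>x \<bullet> b\<bar> < 1" if "b \<in> Basis" for b
    using pq that by (force simp: H_def inner_diff_left)
  define \<epsilon> where "\<epsilon> j = e (j - 1)" for j
  have "(\<Sum>j=1..n. \<epsilon> j *\<^sub>R v j) = (\<Sum>j<n. e j *\<^sub>R v (Suc j))"
    by (simp add: sum.atLeast1_atMost_eq \<epsilon>_def)
  also have "\<dots> = C *\<^sub>R x"
    using C unfolding x_def w_def scaleR_sum_right by (intro sum.cong refl) (simp add: field_simps)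
  finally have "infnorm (\<Sum>j=1..n. \<epsilon> j *\<^sub>R v j) = C * infnorm x"
    using C by (simp add: infnorm_mul)
  also have "infnorm x < 1"
    using xb by (simp add: infnorm_Max)
  then have "C * infnorm x < C * 1" using C by (intro mult_strict_left_mono) auto
  finally show ?thesis
    using e by (intro exI[of _ \<epsilon>]) (auto simp: \<epsilon>_def)
qed

section \<open>Numerical bounds\<close>

lemma exp_minus_taylor:
  fixes y :: real
  assumes "0 \<le> y"
  shows "even n \<Longrightarrow> (\<Sum>k<n. (- y) ^ k / fact k) \<le> exp (- y)"
    and "odd n \<Longrightarrow> exp (- y) \<le> (\<Sum>k<n. (- y) ^ k / fact k)"
proof -
  obtain t where t: "exp (- y) = (\<Sum>k<n. (- y) ^ k / fact k) + (exp t / fact n) * (- y) ^ n"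
    using Maclaurin_exp_le[of "- y" n] by blast
  show "(\<Sum>k<n. (- y) ^ k / fact k) \<le> exp (- y)" if "even n"
    using that assms unfolding t by (simp add: zero_le_mult_iff)
  show "exp (- y) \<le> (\<Sum>k<n. (- y) ^ k / fact k)" if "odd n"
    using that assms unfolding t by (simp add: mult_le_0_iff power_minus_odd divide_le_0_iff)
qed

text \<open>By the geometric series, arctan minus the partial sum has derivative (-z^2)^n / (1 +
  z^2), whose sign depends only on the parity of n.\<close>

lemma arctan_partial_sum:
  fixes x :: real
  assumes "0 \<le> x"
  shows "even n \<Longrightarrow> (\<Sum>k<n. (- 1) ^ k * x ^ (2 * k + 1) / real (2 * k + 1)) \<le> arctan x"
    and "odd n \<Longrightarrow> arctan x \<le> (\<Sum>k<n. (- 1) ^ k * x ^ (2 * k + 1) / real (2 * k + 1))"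
proof -
  define p where "p x = (\<Sum>k<n. (- 1) ^ k * x ^ (2 * k + 1) / real (2 * k + 1))" for x :: real
  have term_deriv: "((\<lambda>x. (- 1) ^ k * x ^ (2 * k + 1) / real (2 * k + 1)) has_real_derivative (- z\<^sup>2) ^ k) (at z)" for k z
  proof -
    have "((\<lambda>x. (- 1) ^ k * x ^ (2 * k + 1) / real (2 * k + 1)) has_real_derivative
        (- 1) ^ k * (real (2 * k + 1) * z ^ (2 * k)) / real (2 * k + 1)) (at z)"
      by (intro DERIV_cdivide DERIV_cmult) (use DERIV_pow[of "2 * k + 1" z] in simp)
    moreover have "(- 1) ^ k * (real (2 * k + 1) * z ^ (2 * k)) / real (2 * k + 1) = (- z\<^sup>2) ^ k"
      by (simp add: power_minus[of "z\<^sup>2"] power_mult del: of_nat_Suc of_nat_add)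
    ultimately show ?thesis by (simp only:)
  qed
  have pos: "0 < 1 + z\<^sup>2" for z :: real by (simp add: add_pos_nonneg)
  have d: "((\<lambda>x. arctan x - p x) has_real_derivative (- z\<^sup>2) ^ n / (1 + z\<^sup>2)) (at z)" for z
  proof -
    have "((\<lambda>x. arctan x - p x) has_real_derivative inverse (1 + z\<^sup>2) - (\<Sum>k<n. (- z\<^sup>2) ^ k)) (at z)"
      unfolding p_def by (intro DERIV_diff DERIV_arctan DERIV_sum term_deriv)
    also have "(\<Sum>k<n. (- z\<^sup>2) ^ k) = (1 - (- z\<^sup>2) ^ n) / (1 + z\<^sup>2)"
      using pos[of z] by (subst sum_gp_strict) (auto simp: add_nonneg_eq_0_iff)
    also have "inverse (1 + z\<^sup>2) - (1 - (- z\<^sup>2) ^ n) / (1 + z\<^sup>2) = (- z\<^sup>2) ^ n / (1 + z\<^sup>2)"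
      using pos[of z] by (simp add: diff_divide_distrib inverse_eq_divide)
    finally show ?thesis .
  qed
  have p0: "p 0 = 0" by (simp add: p_def)
  show "(\<Sum>k<n. (- 1) ^ k * x ^ (2 * k + 1) / real (2 * k + 1)) \<le> arctan x" if "even n"
  proof -
    have "arctan 0 - p 0 \<le> arctan x - p x"
    proof (rule DERIV_nonneg_imp_nondecreasing[OF assms])
      fix z :: real
      have "0 \<le> (- z\<^sup>2) ^ n / (1 + z\<^sup>2)"
        using that pos[of z] by (simp add: zero_le_even_power)
      then show "\<exists>d. ((\<lambda>x. arctan x - p x) has_real_derivative d) (at z) \<and> 0 \<le> d"
        using d by blast
    qed
    then show ?thesis by (simp add: p0 p_def)
  qed
  show "arctan x \<le> (\<Sum>k<n. (- 1) ^ k * x ^ (2 * k + 1) / real (2 * k + 1))" if "odd n"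
  proof -
    have "arctan x - p x \<le> arctan 0 - p 0"
    proof (rule DERIV_nonpos_imp_nonincreasing[OF assms])
      fix z :: real
      have "(- z\<^sup>2) ^ n / (1 + z\<^sup>2) \<le> 0"
        using that pos[of z] by (simp add: power_minus_odd divide_le_0_iff)
      then show "\<exists>d. ((\<lambda>x. arctan x - p x) has_real_derivative d) (at z) \<and> d \<le> 0"
        using d by blast
    qed
    then show ?thesis by (simp add: p0 p_def)
  qed
qed

lemma pi_bounds: "3.14159265358 \<le> pi" "pi \<le> 3.14159265359"
proof -
  \<comment> \<open>Machin's formula subtracts the second arctangent, so each bound for pi pairs a
    lower bound for one with an upper bound for the other; the total error is below 10^-11.\<close>
  have "(\<Sum>k<8. (- 1) ^ k * (1 / 5) ^ (2 * k + 1) / real (2 * k + 1)) \<le> arctan (1 / 5)"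
    "arctan (1 / 5) \<le> (\<Sum>k<9. (- 1) ^ k * (1 / 5) ^ (2 * k + 1) / real (2 * k + 1))"
    "(\<Sum>k<4. (- 1) ^ k * (1 / 239) ^ (2 * k + 1) / real (2 * k + 1)) \<le> arctan (1 / 239)"
    "arctan (1 / 239) \<le> (\<Sum>k<3. (- 1) ^ k * (1 / 239) ^ (2 * k + 1) / real (2 * k + 1))"
    by (rule arctan_partial_sum; simp)+
  then show "3.14159265358 \<le> pi" "pi \<le> 3.14159265359"
    using machin by (simp_all add: lessThan_nat_numeral power_numeral_reduce)
qed

text \<open>With r = 3 u this is a power of 3 times the Beta value B(2k + 1, 3).\<close>

lemma has_integral_moment:
  "((\<lambda>r. (1 - r / 3)\<^sup>2 * r ^ (2 * k)) has_integral
     3 ^ (2 * k + 1) * (2 / (real (2 * k + 1) * real (2 * k + 2) * real (2 * k + 3)))) {0..3}"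
proof -
  define F where "F r = r ^ (2 * k + 1) / real (2 * k + 1) - 2 / 3 * (r ^ (2 * k + 2) / real (2 * k + 2)) + 1 / 9 * (r ^ (2 * k + 3) / real (2 * k + 3))" for r :: real
  have pw: "((\<lambda>r. r ^ Suc n / real (Suc n)) has_real_derivative r ^ n) (at r within S)" for n S and r :: real
    by (rule derivative_eq_intros | simp del: of_nat_Suc)+
  have "((\<lambda>r. (1 - r / 3)\<^sup>2 * r ^ (2 * k)) has_integral F 3 - F 0) {0..3}"
  proof (rule fundamental_theorem_of_calculus)
    fix r :: real assume "r \<in> {0..3}"
    have "(F has_real_derivative r ^ (2 * k) - 2 / 3 * r ^ (2 * k + 1) + 1 / 9 * r ^ (2 * k + 2)) (at r within {0..3})"
      unfolding F_def using pw[of "2 * k" r] pw[of "2 * k + 1" r] pw[of "2 * k + 2" r]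
      by (intro DERIV_add DERIV_diff DERIV_cmult) (simp_all add: eval_nat_numeral del: of_nat_Suc)
    then have "(F has_real_derivative (1 - r / 3)\<^sup>2 * r ^ (2 * k)) (at r within {0..3})"
      by (rule DERIV_cong) (simp add: power2_eq_square field_simps)
    then show "(F has_vector_derivative (1 - r / 3)\<^sup>2 * r ^ (2 * k)) (at r within {0..3})"
      by (simp add: has_real_derivative_iff_has_vector_derivative)
  qed simp
  moreover have "F 3 - F 0 = 3 ^ (2 * k + 1) * (1 / real (2 * k + 1) - 2 / real (2 * k + 2) + 1 / real (2 * k + 3))"
    by (simp add: F_def power_add field_simps)
  moreover have "1 / real (2 * k + 1) - 2 / real (2 * k + 2) + 1 / real (2 * k + 3) = 2 / (real (2 * k + 1) * real (2 * k + 2) * real (2 * k + 3))"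
    by (simp add: divide_simps) (simp add: algebra_simps)
  ultimately show ?thesis by simp
qed

definition taylor_moment :: "nat \<Rightarrow> real \<Rightarrow> real" where
  "taylor_moment n a = (\<Sum>k<n. (- a) ^ k / fact k * (3 ^ (2 * k + 1) * (2 / (real (2 * k + 1) * real (2 * k + 2) * real (2 * k + 3)))))"


text \<open>Horner form, so that inserting a decimal a leaves short rational arithmetic.\<close>

lemma taylor_moment_10: "taylor_moment 10 a = 1 - a * (9 / 10 - a * (81 / 70 - a * (81 / 56 - a * (729 / 440 - a * (19683 / 11440 - a * (59049 / 36400 - a * (531441 / 380800 - a * (1594323 / 1447040 - a * (4782969 / 5958400)))))))))"
  unfolding taylor_moment_def
  by (simp add: lessThan_nat_numeral fact_numeral power_numeral_reduce right_diff_distrib)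

lemma taylor_moment_9: "taylor_moment 9 a = 1 - a * (9 / 10 - a * (81 / 70 - a * (81 / 56 - a * (729 / 440 - a * (19683 / 11440 - a * (59049 / 36400 - a * (531441 / 380800 - a * (1594323 / 1447040))))))))"
  unfolding taylor_moment_def
  by (simp add: lessThan_nat_numeral fact_numeral power_numeral_reduce right_diff_distrib)

lemma has_integral_taylor:
  "((\<lambda>r. (1 - r / 3)\<^sup>2 * (\<Sum>k<n. (- (a * r\<^sup>2)) ^ k / fact k)) has_integral taylor_moment n a) {0..3}"
proof -
  have "((\<lambda>r. \<Sum>k<n. (- a) ^ k / fact k * ((1 - r / 3)\<^sup>2 * r ^ (2 * k))) has_integral
     (\<Sum>k<n. (- a) ^ k / fact k * (3 ^ (2 * k + 1) * (2 / (real (2 * k + 1) * real (2 * k + 2) * real (2 * k + 3)))))) {0..3}"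
    by (intro has_integral_sum has_integral_mult_right has_integral_moment) auto
  moreover have "(\<Sum>k<n. (- a) ^ k / fact k * ((1 - r / 3)\<^sup>2 * r ^ (2 * k))) = (1 - r / 3)\<^sup>2 * (\<Sum>k<n. (- (a * r\<^sup>2)) ^ k / fact k)" for r
    unfolding sum_distrib_left
  proof (intro sum.cong refl)
    fix k
    have "(- (a * r\<^sup>2)) ^ k = (- a) ^ k * r ^ (2 * k)"
      by (simp only: minus_mult_left power_mult_distrib power_mult)
    then show "(- a) ^ k / fact k * ((1 - r / 3)\<^sup>2 * r ^ (2 * k)) = (1 - r / 3)\<^sup>2 * ((- (a * r\<^sup>2)) ^ k / fact k)"
      by simp
  qed
  ultimately show ?thesis unfolding taylor_moment_def by (simp only:)
qed

lemma weight_integrable: "(\<lambda>r. (1 - r / 3)\<^sup>2 * exp (- (pi\<^sup>2 * r\<^sup>2 / (2 * C\<^sup>2)))) integrable_on {0..3}" if "0 < C" for C :: real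
  using that by (intro integrable_continuous_real) (auto intro!: continuous_intros)

text \<open>Every rounding goes down: \<open>a\<close> is too large in a decreasing exponential, the
  root of 2 pi is rounded down, and an even number of Taylor terms stays below. The companion bound
  reverses each of these.\<close>

lemma cos_lhs_gt_1: "1 < cos_lhs 6.9012574"
proof -
  define a :: real where "a = 0.1036127732715"
  have a: "pi\<^sup>2 / (2 * 6.9012574\<^sup>2) \<le> a"
  proof -
    have "pi\<^sup>2 \<le> 3.14159265359\<^sup>2" using pi_bounds by (intro power_mono) auto
    also have "\<dots> \<le> a * (2 * 6.9012574\<^sup>2)" by (simp add: a_def power2_eq_square)
    finally show ?thesis by (simp add: field_simps)
  qed
  have "2.506628274627 \<le> sqrt (2 * pi)"
    using pi_bounds by (intro real_le_rsqrt) (simp add: power2_eq_square)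
  moreover have "taylor_moment 10 a
     \<le> integral {0..3} (\<lambda>r. (1 - r / 3)\<^sup>2 * exp (- (pi\<^sup>2 * r\<^sup>2 / (2 * 6.9012574\<^sup>2))))"
  proof (rule has_integral_le[OF has_integral_taylor integrable_integral[OF weight_integrable]])
    fix r :: real
    have "(\<Sum>k<10. (- (a * r\<^sup>2)) ^ k / fact k) \<le> exp (- (a * r\<^sup>2))"
      by (rule exp_minus_taylor) (auto simp: a_def)
    also have "\<dots> \<le> exp (- (pi\<^sup>2 * r\<^sup>2 / (2 * 6.9012574\<^sup>2)))"
      using mult_right_mono[OF a, of "r\<^sup>2"] by simp
    finally show "(1 - r / 3)\<^sup>2 * (\<Sum>k<10. (- (a * r\<^sup>2)) ^ k / fact k) \<le> (1 - r / 3)\<^sup>2 * exp (- (pi\<^sup>2 * r\<^sup>2 / (2 * 6.9012574\<^sup>2)))"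
      by (intro mult_left_mono) auto
  qed simp
  ultimately have "3 * 2.506628274627 / 6.9012574 * taylor_moment 10 a
     \<le> cos_lhs 6.9012574"
    unfolding cos_lhs_def
  proof (intro mult_mono divide_right_mono mult_left_mono)
    show "0 \<le> taylor_moment 10 a" by (simp add: taylor_moment_10 a_def)
  qed auto
  moreover have "1 < 3 * 2.506628274627 / 6.9012574 * taylor_moment 10 a"
    by (simp add: taylor_moment_10 a_def)
  ultimately show ?thesis by simp
qed

lemma cos_lhs_less_1: "cos_lhs 6.9012575 < 1"
proof -
  define a :: real where "a = 0.103612770268"
  have a: "a \<le> pi\<^sup>2 / (2 * 6.9012575\<^sup>2)"
  proof -
    have "a * (2 * 6.9012575\<^sup>2) \<le> 3.14159265358\<^sup>2" by (simp add: a_def power2_eq_square)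
    also have "\<dots> \<le> pi\<^sup>2" using pi_bounds by (intro power_mono) auto
    finally show ?thesis by (simp add: field_simps)
  qed
  have "sqrt (2 * pi) \<le> 2.506628274632"
    using pi_bounds by (intro real_le_lsqrt) (simp_all add: power2_eq_square)
  moreover have "integral {0..3} (\<lambda>r. (1 - r / 3)\<^sup>2 * exp (- (pi\<^sup>2 * r\<^sup>2 / (2 * 6.9012575\<^sup>2))))
     \<le> taylor_moment 9 a"
  proof (rule has_integral_le[OF integrable_integral[OF weight_integrable] has_integral_taylor])
    fix r :: real
    have "exp (- (pi\<^sup>2 * r\<^sup>2 / (2 * 6.9012575\<^sup>2))) \<le> exp (- (a * r\<^sup>2))"
      using mult_right_mono[OF a, of "r\<^sup>2"] by simp
    also have "\<dots> \<le> (\<Sum>k<9. (- (a * r\<^sup>2)) ^ k / fact k)"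
      by (rule exp_minus_taylor) (auto simp: a_def)
    finally show "(1 - r / 3)\<^sup>2 * exp (- (pi\<^sup>2 * r\<^sup>2 / (2 * 6.9012575\<^sup>2))) \<le> (1 - r / 3)\<^sup>2 * (\<Sum>k<9. (- (a * r\<^sup>2)) ^ k / fact k)"
      by (intro mult_left_mono) auto
  qed simp
  ultimately have "cos_lhs 6.9012575 \<le> 3 * 2.506628274632 / 6.9012575 * taylor_moment 9 a"
    unfolding cos_lhs_def
    by (intro mult_mono divide_right_mono mult_left_mono)
       (auto intro!: integral_nonneg weight_integrable)
  also have "\<dots> < 1"
    by (simp add: taylor_moment_9 a_def)
  finally show ?thesis .
qed

section \<open>The constant\<close>

text \<open>In the defining form the prefactor decreases in C while the exponential increases. After
  integration by parts the integrand is \<open>normal_tv (pi * r / C)\<close> with a fixed weight,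
  which decreases for every r > 0.\<close>

lemma cos_lhs_strict_antimono:
  assumes "0 < C" "C < C'"
  shows "cos_lhs C' < cos_lhs C"
proof -
  have cont: "continuous_on {0..3} (\<lambda>r. (1 - r / 3) * normal_tv (pi * r / C))" if "0 < C" for C
    using that by (auto intro!: continuous_intros continuous_on_compose2[OF normal_tv_continuous[of UNIV]])
  have "integral {0..3} (\<lambda>r. (1 - r / 3) * normal_tv (pi * r / C')) < integral {0..3} (\<lambda>r. (1 - r / 3) * normal_tv (pi * r / C))"
  proof (rule integral_less_real)
    show "(1 - r / 3) * normal_tv (pi * r / C') < (1 - r / 3) * normal_tv (pi * r / C)" if "r \<in> {0<..<3}" for r
      using that assms by (intro mult_strict_left_mono normal_tv_strict_mono divide_strict_left_mono) auto
  qed (use assms cont in auto)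
  then show ?thesis using assms by (simp add: integral_normal_tv)
qed

lemma cos_lhs_continuous:
  assumes "0 < a"
  shows "continuous_on {a..b} cos_lhs"
proof -
  have "continuous_on ({a..b} \<times> cbox 0 3) (\<lambda>(C, r). (1 - r / 3) * normal_tv (pi * r / C))"
    unfolding case_prod_unfold using assms
    by (auto intro!: continuous_intros continuous_on_compose2[OF normal_tv_continuous[of UNIV]])
  then have "continuous_on {a..b} (\<lambda>C. integral (cbox 0 3) (\<lambda>r. (1 - r / 3) * normal_tv (pi * r / C)))"
    by (rule integral_continuous_on_param)
  then have "continuous_on {a..b} (\<lambda>C. 2 * integral {0..3} (\<lambda>r. (1 - r / 3) * normal_tv (pi * r / C)))"
    unfolding cbox_interval by (rule continuous_on_mult_left)
  then show ?thesis
    by (rule continuous_on_eq) (use assms in \<open>simp add: integral_normal_tv\<close>)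
qed

theorem theorem2p4:
  shows "(\<exists>!C::real. C > 0 \<and> cos_lhs C = 1)
    \<and> C_cos \<in> {6.9012574<..<6.9012575}
    \<and> (\<forall>(n::nat) (v :: nat \<Rightarrow> real ^ 'd).
          n \<ge> 1 \<longrightarrow> (\<forall>j\<in>{1..n}. norm (v j) \<le> 1) \<longrightarrow>
          (\<exists>\<epsilon> :: nat \<Rightarrow> real. (\<forall>j\<in>{1..n}. \<epsilon> j \<in> {-1, 1}) \<and>
             infnorm (\<Sum>j=1..n. \<epsilon> j *\<^sub>R v j) < C_cos))
    \<and> C_cos < 6.9013"
proof -
  have "\<exists>C\<ge>6.9012574. C \<le> 6.9012575 \<and> cos_lhs C = 1"
    using cos_lhs_gt_1 cos_lhs_less_1 by (intro IVT2' cos_lhs_continuous) auto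
  then obtain C where C: "6.9012574 \<le> C" "C \<le> 6.9012575" "cos_lhs C = 1" by auto
  have "C \<noteq> 6.9012574" "C \<noteq> 6.9012575"
    using C(3) cos_lhs_gt_1 cos_lhs_less_1 by (metis less_irrefl)+
  then have C': "6.9012574 < C" "C < 6.9012575" using C by auto
  have unique: "C'' = C" if "0 < C'' \<and> cos_lhs C'' = 1" for C''
    using cos_lhs_strict_antimono[of C C''] cos_lhs_strict_antimono[of C'' C] that C
    by (cases C C'' rule: linorder_cases) auto
  have ex1: "\<exists>!C::real. C > 0 \<and> cos_lhs C = 1"
    by (rule ex1I[of _ C]) (use C unique in auto)
  have "C_cos = C"
    unfolding C_cos_def by (rule the_equality) (use C unique in auto)
  moreover have "\<exists>\<epsilon> :: nat \<Rightarrow> real. (\<forall>j\<in>{1..n}. \<epsilon> j \<in> {-1, 1}) \<and> infnorm (\<Sum>j=1..n. \<epsilon> j *\<^sub>R v j) < C"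
    if "\<forall>j\<in>{1..n}. norm (v j) \<le> 1" for n and v :: "nat \<Rightarrow> real ^ 'd"
    using that C by (intro signed_sum_infnorm_less) auto
  ultimately show ?thesis using ex1 C' by auto
qed

end
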